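(* Let $k\geq 6$ be an integer. If $G$ is a graph of chromatic number $k+1$ that contains no triangle $K_3$ as a subgraph, then $G$ contains $k$ cycles of consecutive lengths, i.e. there is an integer $\ell$ such that $G$ contains cycles of lengths $\ell,\ell+1,\ldots,\ell+k-1$.
   Context: Graphs are finite and simple; the length of a cycle is its number of edges. *)

theory Defs
  imports Main
begin

definition simple_graph :: "'a set \<Rightarrow> ('a \<Rightarrow> 'a \<Rightarrow> bool) \<Rightarrow> bool" where
  "simple_graph V E \<longleftrightarrow> finite V \<and> (\<forall>u v. E u v \<longrightarrow> E v u) \<and> (\<forall>v. \<not> E v v)
     \<and> (\<forall>u v. E u v \<longrightarrow> u \<in> V \<and> v \<in> V)"

definition colourable :: "'a set \<Rightarrow> ('a \<Rightarrow> 'a \<Rightarrow> bool) \<Rightarrow> nat \<Rightarrow> bool" where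
  "colourable V E k \<longleftrightarrow> (\<exists>c :: 'a \<Rightarrow> nat. (\<forall>v\<in>V. c v < k)
      \<and> (\<forall>u\<in>V. \<forall>v\<in>V. E u v \<longrightarrow> c u \<noteq> c v))"

definition chromatic_number :: "'a set \<Rightarrow> ('a \<Rightarrow> 'a \<Rightarrow> bool) \<Rightarrow> nat" where
  "chromatic_number V E = (LEAST k. colourable V E k)"

definition triangle_free :: "'a set \<Rightarrow> ('a \<Rightarrow> 'a \<Rightarrow> bool) \<Rightarrow> bool" where
  "triangle_free V E \<longleftrightarrow> \<not> (\<exists>a\<in>V. \<exists>b\<in>V. \<exists>c\<in>V. E a b \<and> E b c \<and> E c a)"

definition has_cycle_of_length :: "'a set \<Rightarrow> ('a \<Rightarrow> 'a \<Rightarrow> bool) \<Rightarrow> nat \<Rightarrow> bool" where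
  "has_cycle_of_length V E n \<longleftrightarrow> n \<ge> 3 \<and> (\<exists>vs. length vs = n \<and> distinct vs \<and> set vs \<subseteq> V
      \<and> (\<forall>i<n. E (vs ! i) (vs ! ((i + 1) mod n))))"

end

theory Submission
  imports Defs
begin

text \<open>A graph of chromatic number \<open>k + 1\<close> has a breadth-first level that is not \<open>d\<close>-colourable
  for \<open>d = k div 2\<close>, as alternating two palettes over the levels would colour the graph with
  \<open>2 * d\<close> colours. A minimal non-\<open>d\<close>-colourable part \<open>H\<close> of this level contains, by a rotation
  argument on a longest path, a cycle with a chord on \<open>n > k\<close> vertices, since \<open>H\<close> is triangle-free
  and \<open>d\<close> is at least 3. Hence, as in the lemma of Bondy and Simonovits, for every non-constant
  2-colouring of \<open>H\<close> there are paths in \<open>H\<close> of all lengths below \<open>n\<close> with ends of different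
  colours. Colouring \<open>H\<close> by the branches of the breadth-first tree, each such path is closed
  through the tree by the same number \<open>2 * h\<close> of further edges.\<close>

text \<open>Minimum degree \<open>d\<close> alone promises a cycle on only \<open>d + 1\<close>
  vertices. Here \<open>2 * d + 2\<close> are needed, since \<open>k\<close> can be
  \<open>2 * d + 1\<close> and the path lengths 1, ..., \<open>k\<close> must all stay below
  \<open>n\<close>; the factor two is what triangle-freeness buys. If no path of length
  \<open>l\<close> has ends of different colours, the colouring is \<open>l\<close>-periodic along
  the cycle. Paths through the chord then leave only constant and alternating colourings of the
  cycle. The alternating one is a genuine obstacle: in a properly 2-coloured bipartite graph the
  ends of a path of even length always agree. It is overcome because a graph that is not
  \<open>d\<close>-colourable with \<open>d >= 3\<close> is not bipartite, so every 2-colouring has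
  a monochromatic edge. This is one use of \<open>k >= 6\<close>; others are the third neighbour
  that provides the chord and the counting on a longest path.\<close>

section \<open>Periodic colourings of a cycle\<close>

text \<open>Chord paths of length \<open>l\<close> exist only for a bounded range of positions. The
  identities they give extend to all integers as soon as the range covers one full period, wherever
  it starts.\<close>

lemma periodic_window:
  fixes t :: int
  assumes t: "0 < t" and per: "\<And>i. Q (i + t) = Q i" and win: "\<And>i. u \<le> i \<Longrightarrow> i < u + t \<Longrightarrow> Q i"
  shows "Q i"
proof -
  have nat_mult: "Q (i + t * int m) = Q i" for i m
  proof (induction m)
    case (Suc m)
    have "i + t * int (Suc m) = (i + t * int m) + t" by (simp add: algebra_simps)
    then show ?case using Suc.IH per[of "i + t * int m"] by (simp only:)
  qed simp
  have mult: "Q (i + t * k) = Q i" for i k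
  proof (cases "0 \<le> k")
    case True
    with nat_mult[of i "nat k"] show ?thesis by simp
  next
    case False
    with nat_mult[of "i + t * k" "nat (- k)"] show ?thesis by simp
  qed
  let ?j = "u + (i - u) mod t"
  have "i = ?j + t * ((i - u) div t)" by simp
  moreover have "Q ?j" using t by (intro win) simp_all
  ultimately show ?thesis using mult[of ?j "(i - u) div t"] by simp
qed

text \<open>Here \<open>f\<close> colours a cycle of length \<open>n\<close> with chord from \<open>0\<close> to \<open>r\<close>. The premise
  \<open>per_l\<close> says that no arc of length \<open>l\<close> has ends of different colours, and \<open>t1\<close>, \<open>t2\<close>,
  \<open>t3\<close> say the same of the three kinds of paths of length \<open>l\<close> through the chord.\<close>

lemma theta_colouring_alternates:
  fixes f :: "int \<Rightarrow> bool" and n r l :: int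
  assumes per_n: "\<And>i. f (i + n) = f i" and per_l: "\<And>i. f (i + l) = f i"
    and l: "0 < l" "l < n" and r: "2 \<le> r" "2 * r \<le> n"
    and t1: "\<And>a. 0 \<le> a \<Longrightarrow> a < l \<Longrightarrow> l \<le> n - r \<Longrightarrow> f (- a) = f (r + (l - 1 - a))"
    and t2: "\<And>a. 0 \<le> a \<Longrightarrow> a < l \<Longrightarrow> a < n - r \<Longrightarrow> l - 1 - a < r \<Longrightarrow> f (- a) = f (r - (l - 1 - a))"
    and t3: "\<And>a. 0 \<le> a \<Longrightarrow> a < l \<Longrightarrow> a < r \<Longrightarrow> l - 1 - a < n - r \<Longrightarrow> f a = f (r + (l - 1 - a))"
    and nonconst: "f u \<noteq> f v"
  shows "(\<forall>i. f (i + 1) \<noteq> f i) \<and> f r \<noteq> f 0"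
proof -
  define P where "P d \<longleftrightarrow> (\<forall>i. f (i + d) = f i)" for d
  have P_diff: "P (d - e)" if "P d" "P e" for d e
    unfolding P_def
  proof
    fix i
    have "f (i + (d - e)) = f (i + (d - e) + e)" using \<open>P e\<close> unfolding P_def by blast
    also have "i + (d - e) + e = i + d" by simp
    finally show "f (i + (d - e)) = f i" using \<open>P d\<close> by (simp add: P_def)
  qed
  define T where "T = (LEAST k. 0 < k \<and> P (int k))"
  define t where "t = int T"
  have "0 < nat l \<and> P (int (nat l))" using l per_l by (simp add: P_def)
  then have T: "0 < T \<and> P (int T)" unfolding T_def by (rule LeastI)
  then have t: "0 < t" "P t" by (simp_all add: t_def)
  have t_min: "t \<le> d" if "0 < d" "P d" for d
  proof -
    have "T \<le> nat d" unfolding T_def using that by (intro Least_le) simp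
    with that show ?thesis by (simp add: t_def)
  qed
  have "P l" "P n" using per_l per_n by (simp_all add: P_def)
  with P_diff have "P (n - l)" by blast
  have tl: "t \<le> l" "l \<le> n - t"
    using t_min[OF _ \<open>P l\<close>] t_min[OF _ \<open>P (n - l)\<close>] l by simp_all
  have not1: "\<not> P 1"
  proof
    assume "P 1"
    then have "f (i + 1) = f i" for i by (simp add: P_def)
    have "f i = f 0" for i
    proof (rule periodic_window[where t = 1 and u = 0 and Q = "\<lambda>i. f i = f 0"])
      fix i :: int assume "0 \<le> i" "i < 0 + 1"
      then have "i = 0" by simp
      then show "f i = f 0" by simp
    qed (use \<open>P 1\<close> in \<open>simp_all add: P_def\<close>)
    from this[of u] this[of v] nonconst show False by simp
  qed
  have per_t: "f (i + t) = f i" for i using t by (simp add: P_def)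
  have per_t': "f (i - t) = f i" for i using per_t[of "i - t"] by simp
  have per_l': "f (i - l) = f i" for i using per_l[of "i - l"] by simp
  show ?thesis
  proof (cases "r < t")
    case True
    \<comment> \<open>Modulo the period \<open>l\<close>, \<open>t1\<close> says that
      \<open>r - 1\<close> is a period; it is positive and smaller than \<open>t\<close>, a
      contradiction.\<close>
    have "f (i + (r - 1)) = f i" for i
    proof (rule periodic_window[where t = t and u = "1 - t" and Q = "\<lambda>i. f (i + (r - 1)) = f i"])
      fix i assume i: "1 - t \<le> i" "i < 1 - t + t"
      have "f i = f (r + (l - 1 + i))" using t1[of "- i"] i tl True by simp
      also have "\<dots> = f (i + (r - 1))" using per_l[of "i + (r - 1)"] by (simp add: algebra_simps)
      finally show "f (i + (r - 1)) = f i" by simp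
    next
      fix i show "(f (i + t + (r - 1)) = f (i + t)) = (f (i + (r - 1)) = f i)"
        using per_t[of i] per_t[of "i + (r - 1)"] by (simp add: algebra_simps)
    qed (use t in auto)
    then have "P (r - 1)" by (simp add: P_def)
    with t_min[of "r - 1"] r True show ?thesis by simp
  next
    case False
    \<comment> \<open>Modulo \<open>l\<close>, \<open>t2\<close> and \<open>t3\<close> become two
      reflections whose composition is the shift by 2. Both windows hold \<open>t\<close> integers
      because \<open>t \<le> r \<le> n - r\<close> and \<open>l + t \<le> n\<close>; this one ends
      its descent at the largest \<open>a\<close> below both \<open>l\<close> and
      \<open>n - r\<close>.\<close>
    have refl1: "f i = f (r + 1 - i)" for i
    proof (rule periodic_window[where t = t and u = "1 - min (n - r) l" and Q = "\<lambda>i. f i = f (r + 1 - i)"])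
      fix i assume i: "1 - min (n - r) l \<le> i" "i < 1 - min (n - r) l + t"
      have "f i = f (r - (l - 1 + i))" using t2[of "- i"] i tl False r by simp
      also have "\<dots> = f (r + 1 - i)" using per_l'[of "r + 1 - i"] by (simp add: algebra_simps)
      finally show "f i = f (r + 1 - i)" .
    next
      fix i show "(f (i + t) = f (r + 1 - (i + t))) = (f i = f (r + 1 - i))"
        using per_t[of i] per_t'[of "r + 1 - i"] by (simp add: algebra_simps)
    qed (use t in auto)
    have refl2: "f i = f (r - 1 - i)" for i
    proof (rule periodic_window[where t = t and u = "max 0 (l - (n - r))" and Q = "\<lambda>i. f i = f (r - 1 - i)"])
      fix i assume i: "max 0 (l - (n - r)) \<le> i" "i < max 0 (l - (n - r)) + t"
      have "f i = f (r + (l - 1 - i))" using t3[of i] i tl False r by simp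
      also have "\<dots> = f (r - 1 - i)" using per_l[of "r - 1 - i"] by (simp add: algebra_simps)
      finally show "f i = f (r - 1 - i)" .
    next
      fix i show "(f (i + t) = f (r - 1 - (i + t))) = (f i = f (r - 1 - i))"
        using per_t[of i] per_t'[of "r - 1 - i"] by (simp add: algebra_simps)
    qed (use t in auto)
    have per2: "f (i + 2) = f i" for i
    proof -
      have "f i = f (r - 1 - i)" by (rule refl2)
      also have "\<dots> = f (r + 1 - (r - 1 - i))" by (rule refl1)
      also have "r + 1 - (r - 1 - i) = i + 2" by simp
      finally show ?thesis by simp
    qed
    have alt: "f (i + 1) \<noteq> f i" for i
    proof
      assume eq: "f (i + 1) = f i"
      have "f (j + 1) = f j" for j
      proof (rule periodic_window[where t = 2 and u = i and Q = "\<lambda>j. f (j + 1) = f j"])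
        fix j assume "i \<le> j" "j < i + 2"
        then have "j = i \<or> j = i + 1" by auto
        then show "f (j + 1) = f j"
        proof
          assume "j = i + 1"
          with eq per2[of i] show ?thesis by (simp add: add.commute)
        qed (use eq in simp)
      next
        fix j show "(f (j + 2 + 1) = f (j + 2)) = (f (j + 1) = f j)"
          using per2[of j] per2[of "j + 1"] by (simp add: add.commute add.left_commute)
      qed auto
      with not1 show False by (simp add: P_def)
    qed
    moreover have "f r \<noteq> f 0" using refl1[of 1] alt[of 0] by simp
    ultimately show ?thesis by blast
  qed
qed

section \<open>Paths through a cycle with a chord\<close>

definition path_in :: "('a \<Rightarrow> 'a \<Rightarrow> bool) \<Rightarrow> 'a set \<Rightarrow> 'a list \<Rightarrow> bool" where
  "path_in E U xs \<longleftrightarrow> distinct xs \<and> successively E xs \<and> set xs \<subseteq> U"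

definition split_path :: "('a \<Rightarrow> 'a \<Rightarrow> bool) \<Rightarrow> 'a set \<Rightarrow> ('a \<Rightarrow> bool) \<Rightarrow> nat \<Rightarrow> bool" where
  "split_path E U c l \<longleftrightarrow>
    (\<exists>xs. path_in E U xs \<and> length xs = Suc l \<and> c (hd xs) \<noteq> c (last xs))"

text \<open>A cycle of length \<open>n\<close> is an \<open>n\<close>-periodic enumeration of its vertices by the integers.\<close>

definition cycle_map :: "('a \<Rightarrow> 'a \<Rightarrow> bool) \<Rightarrow> 'a set \<Rightarrow> int \<Rightarrow> (int \<Rightarrow> 'a) \<Rightarrow> bool" where
  "cycle_map E U n g \<longleftrightarrow> 3 \<le> n \<and> (\<forall>i j. g i = g j \<longleftrightarrow> i mod n = j mod n)
    \<and> (\<forall>i. E (g i) (g (i + 1))) \<and> range g \<subseteq> U"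

definition theta_map :: "('a \<Rightarrow> 'a \<Rightarrow> bool) \<Rightarrow> 'a set \<Rightarrow> int \<Rightarrow> (int \<Rightarrow> 'a) \<Rightarrow> int \<Rightarrow> bool" where
  "theta_map E U n g r \<longleftrightarrow> cycle_map E U n g \<and> E (g 0) (g r) \<and> 2 \<le> r \<and> r \<le> n - 2"

lemma split_pathI:
  "path_in E U xs \<Longrightarrow> length xs = Suc l \<Longrightarrow> c (hd xs) \<noteq> c (last xs) \<Longrightarrow> split_path E U c l"
  unfolding split_path_def by blast

lemma path_in_append:
  assumes "path_in E U xs" "path_in E U ys" "set xs \<inter> set ys = {}"
    "xs \<noteq> [] \<Longrightarrow> ys \<noteq> [] \<Longrightarrow> E (last xs) (hd ys)"
  shows "path_in E U (xs @ ys)"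
  using assms by (auto simp: path_in_def successively_append_iff)

lemma path_in_drop: "path_in E U xs \<Longrightarrow> path_in E U (drop k xs)"
  by (metis append_take_drop_id distinct_drop path_in_def set_drop_subset subset_trans
      successively_append_iff)

lemma path_in_rev:
  assumes "\<And>u v. E u v \<Longrightarrow> E v u" "path_in E U xs"
  shows "path_in E U (rev xs)"
proof -
  have "(\<lambda>x y. E y x) = E" using assms(1) by blast
  then show ?thesis using assms(2) by (simp add: path_in_def del: successively_rev)
      (simp only: successively_rev)
qed

lemma cycle_map_period: "cycle_map E U n g \<Longrightarrow> g (i + n) = g i"
  by (simp add: cycle_map_def)

lemma cycle_map_edge: "cycle_map E U n g \<Longrightarrow> E (g i) (g (i + 1))"
  by (simp add: cycle_map_def)

lemma cycle_map_in: "cycle_map E U n g \<Longrightarrow> g i \<in> U"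
  by (auto simp: cycle_map_def)

lemma cycle_map_eqD:
  assumes "cycle_map E U n g" "g i = g j" "\<bar>i - j\<bar> < n"
  shows "i = j"
proof -
  have "n dvd i - j" using assms(1,2) by (simp add: cycle_map_def mod_eq_dvd_iff)
  with assms(3) show ?thesis
    using dvd_imp_le_int[of "i - j" n] by (cases "i = j") auto
qed

lemma cycle_map_shift: "cycle_map E U n g \<Longrightarrow> cycle_map E U n (\<lambda>i. g (i + s))"
proof -
  assume cyc: "cycle_map E U n g"
  then have "E (g (i + s)) (g (i + 1 + s))" for i
    using cycle_map_edge[OF cyc, of "i + s"] by (simp add: ac_simps)
  with cyc cycle_map_in[OF cyc] show ?thesis by (auto simp: cycle_map_def mod_eq_dvd_iff)
qed

lemma path_in_arc:
  assumes "cycle_map E U n g" "j - i < n"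
  shows "path_in E U (map g [i..j])"
proof -
  have "inj_on g {i..j}"
    using assms by (intro inj_onI) (rule cycle_map_eqD[OF assms(1)], auto)
  moreover have "successively E (map g [i..j])"
    unfolding successively_conv_nth
  proof (intro allI impI)
    fix a assume "Suc a < length (map g [i..j])"
    then show "E (map g [i..j] ! a) (map g [i..j] ! Suc a)"
      using cycle_map_edge[OF assms(1), of "i + int a"] by (simp add: ac_simps)
  qed
  ultimately show ?thesis using assms(1)
    by (auto simp: path_in_def distinct_map cycle_map_def)
qed

lemma arcs_disjoint:
  assumes "cycle_map E U n g" "j < k" "m - i < n"
  shows "g ` {i..j} \<inter> g ` {k..m} = {}"
proof -
  have "g a \<noteq> g b" if "a \<in> {i..j}" "b \<in> {k..m}" for a b
    using cycle_map_eqD[OF assms(1), of a b] assms(2,3) that by auto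
  then show ?thesis by blast
qed

lemma hd_map_upto: "i \<le> j \<Longrightarrow> hd (map g [i..j]) = g i"
  by (simp add: upto.simps)

lemma last_map_upto: "i \<le> j \<Longrightarrow> last (map g [i..j]) = g j"
  by (simp add: upto_rec2)

text \<open>Covers all kinds of paths through a chord at once: run along the first arc from
  \<open>x'\<close> to \<open>x\<close>, cross the chord to \<open>y\<close>, run along the second
  arc to \<open>y'\<close>. The two equivalences make \<open>x'\<close> and \<open>y'\<close> the
  opposite ends, also when an arc is a single vertex.\<close>

lemma split_path_two_arcs:
  assumes cyc: "cycle_map E U n g" and sym: "\<And>u v. E u v \<Longrightarrow> E v u"
    and ord: "i \<le> j" "j < k" "k \<le> m" "m - i < n"
    and edge: "E (g x) (g y)" and xy: "x \<in> {i, j}" "y \<in> {k, m}"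
    and xy': "x' \<in> {i, j}" "y' \<in> {k, m}" "x' = x \<longleftrightarrow> i = j" "y' = y \<longleftrightarrow> k = m"
    and l: "l = nat ((j - i) + (m - k) + 1)"
    and no: "\<not> split_path E U c l"
  shows "c (g x') = c (g y')"
proof -
  define xs where "xs = (if x = j then map g [i..j] else rev (map g [i..j]))"
  define ys where "ys = (if y = k then map g [k..m] else rev (map g [k..m]))"
  have p: "path_in E U (map g [i..j])" "path_in E U (map g [k..m])"
    by (rule path_in_arc[OF cyc]; use ord in simp)+
  have xs: "path_in E U xs" "last xs = g x" "hd xs = g x'" "length xs = nat (j - i + 1)" "set xs = g ` {i..j}" "xs \<noteq> []"
    using p xy(1) xy'(1,3) ord path_in_rev[OF sym p(1)]
    by (auto simp: xs_def hd_map_upto last_map_upto hd_rev last_rev)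
  have ys: "path_in E U ys" "hd ys = g y" "last ys = g y'" "length ys = nat (m - k + 1)" "set ys = g ` {k..m}" "ys \<noteq> []"
    using p xy(2) xy'(2,4) ord path_in_rev[OF sym p(2)]
    by (auto simp: ys_def hd_map_upto last_map_upto hd_rev last_rev)
  have "path_in E U (xs @ ys)"
    using xs ys edge arcs_disjoint[OF cyc ord(2,4)] by (intro path_in_append) auto
  then have "split_path E U c l" if "c (g x') \<noteq> c (g y')"
    using that xs ys ord by (intro split_pathI[of _ _ "xs @ ys"]) (auto simp: l)
  with no show ?thesis by blast
qed

lemma split_path_arc:
  assumes cyc: "cycle_map E U n g" and l: "l < n" "0 \<le> l" and no: "\<not> split_path E U c (nat l)"
  shows "c (g (i + l)) = c (g i)"
proof (rule ccontr)
  assume "c (g (i + l)) \<noteq> c (g i)"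
  then have "split_path E U c (nat l)"
    using path_in_arc[OF cyc, of "i + l" i] l
    by (intro split_pathI[of _ _ "map g [i..i + l]"]) (auto simp: hd_map_upto last_map_upto)
  with no show False ..
qed

text \<open>Reading the chord from its other end exchanges the two arcs between its ends, so the
  shorter one may be taken to have length \<open>r\<close>.\<close>

lemma theta_map_swap:
  assumes th: "theta_map E U n g r" and sym: "\<And>u v. E u v \<Longrightarrow> E v u"
  shows "theta_map E U n (\<lambda>i. g (i + r)) (n - r)"
  using th sym cycle_map_shift[of E U n g r] cycle_map_period[of E U n g 0]
  by (auto simp: theta_map_def)

lemma theta_split_path_short:
  assumes th: "theta_map E U n g r" and sym: "\<And>u v. E u v \<Longrightarrow> E v u"
    and l: "0 < l" "l < n" and no: "\<not> split_path E U c (nat l)"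
    and r: "2 * r \<le> n" and nonconst: "c (g u) \<noteq> c (g v)"
  shows "(\<forall>i. c (g (i + 1)) \<noteq> c (g i)) \<and> c (g r) \<noteq> c (g 0)"
proof (rule theta_colouring_alternates[where n = n and l = l and f = "\<lambda>i. c (g i)"])
  have cyc: "cycle_map E U n g" and e: "E (g 0) (g r)" "E (g r) (g 0)" and r2: "2 \<le> r" "r \<le> n - 2"
    using th sym by (auto simp: theta_map_def)
  show "c (g (i + n)) = c (g i)" for i using cycle_map_period[OF cyc] by simp
  show "c (g (i + l)) = c (g i)" for i using split_path_arc[OF cyc _ _ no] l by simp
  show "2 \<le> r" using r2 by simp
  \<comment> \<open>Of the \<open>l\<close> edges, \<open>a\<close> lie on the side of
    \<open>g 0\<close>, one is the chord, and \<open>l - 1 - a\<close> lie on the side of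
    \<open>g r\<close>. The three cases differ in the directions taken from the ends of the
    chord.\<close>
  note arcs = split_path_two_arcs[OF cyc sym _ _ _ _ e(1) _ _ _ _ _ _ _ no]
  show "c (g (- a)) = c (g (r + (l - 1 - a)))" if "0 \<le> a" "a < l" "l \<le> n - r" for a
    by (rule arcs[of "- a" 0 r "r + (l - 1 - a)"]) (use that r2 in auto)
  show "c (g (- a)) = c (g (r - (l - 1 - a)))" if "0 \<le> a" "a < l" "a < n - r" "l - 1 - a < r" for a
    by (rule arcs[of "- a" 0 "r - (l - 1 - a)" r]) (use that r2 in auto)
  show "c (g a) = c (g (r + (l - 1 - a)))" if "0 \<le> a" "a < l" "a < r" "l - 1 - a < n - r" for a
    by (rule arcs[of 0 a r "r + (l - 1 - a)"]) (use that r2 in auto)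
qed (use assms in auto)

lemma theta_split_path:
  assumes th: "theta_map E U n g r" and sym: "\<And>u v. E u v \<Longrightarrow> E v u"
    and l: "0 < l" "l < n" and no: "\<not> split_path E U c (nat l)"
    and nonconst: "c (g u) \<noteq> c (g v)"
  shows "(\<forall>i. c (g (i + 1)) \<noteq> c (g i)) \<and> c (g r) \<noteq> c (g 0)"
proof (cases "2 * r \<le> n")
  case True
  with theta_split_path_short[OF th sym l no] nonconst show ?thesis by blast
next
  case False
  have "g n = g 0" using th cycle_map_period[of E U n g 0] by (simp add: theta_map_def)
  moreover have "(\<forall>i. c (g (i + 1 + r)) \<noteq> c (g (i + r))) \<and> c (g (n - r + r)) \<noteq> c (g (0 + r))"
    by (rule theta_split_path_short[OF theta_map_swap[OF th sym] sym l no, where u = "u - r" and v = "v - r"])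
      (use False nonconst in auto)
  moreover have "c (g (i + 1)) \<noteq> c (g i)" if "\<forall>i. c (g (i + 1 + r)) \<noteq> c (g (i + r))" for i
    using that[rule_format, of "i - r"] by (simp add: algebra_simps)
  ultimately show ?thesis by auto
qed

section \<open>Connected graphs containing a cycle with a chord\<close>

text \<open>Phrased by sets closed under adjacency instead of walks: this form follows from gluing
  colourings, and it applies directly to sets of reachable vertices.\<close>

definition connected_on :: "'a set \<Rightarrow> ('a \<Rightarrow> 'a \<Rightarrow> bool) \<Rightarrow> bool" where
  "connected_on U E \<longleftrightarrow>
    (\<forall>X \<subseteq> U. X \<noteq> {} \<longrightarrow> (\<forall>x\<in>X. \<forall>y\<in>U. E x y \<longrightarrow> y \<in> X) \<longrightarrow> X = U)"

text \<open>A shortest walk from \<open>X\<close> to \<open>Y\<close> works: cutting out a loop, or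
  the part before a later visit to \<open>X\<close>, or the part after an earlier visit to
  \<open>Y\<close>, would shorten it.\<close>

lemma shortest_path_between:
  assumes conn: "connected_on U E" and X: "X \<subseteq> U" "X \<noteq> {}" and Y: "Y \<subseteq> U" "Y \<noteq> {}"
  obtains xs where "path_in E U xs" "xs \<noteq> []" "hd xs \<in> X" "last xs \<in> Y"
    "set (tl xs) \<inter> X = {}" "set (butlast xs) \<inter> Y = {}"
proof -
  define walk where "walk xs \<longleftrightarrow> xs \<noteq> [] \<and> successively E xs \<and> set xs \<subseteq> U \<and> hd xs \<in> X" for xs
  define Z where "Z = {v. \<exists>xs. walk xs \<and> last xs = v}"
  have "Z = U"
  proof -
    have "Z \<subseteq> U" by (auto simp: Z_def walk_def)
    moreover have "Z \<noteq> {}"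
    proof -
      obtain x where "x \<in> X" using X by blast
      then have "walk [x]" using X by (auto simp: walk_def)
      then show ?thesis by (auto simp: Z_def)
    qed
    moreover have "y \<in> Z" if x: "x \<in> Z" and y: "y \<in> U" "E x y" for x y
    proof -
      obtain xs where "walk xs" "last xs = x" using x by (auto simp: Z_def)
      then have "walk (xs @ [y])" using y by (auto simp: walk_def successively_append_iff)
      then show ?thesis by (force simp: Z_def)
    qed
    ultimately show ?thesis using conn by (auto simp: connected_on_def)
  qed
  define W where "W xs \<longleftrightarrow> walk xs \<and> last xs \<in> Y" for xs
  have "\<exists>xs. W xs" using Y \<open>Z = U\<close> by (auto simp: W_def Z_def)
  then obtain xs where W: "W xs" and min: "\<And>ys. W ys \<Longrightarrow> length xs \<le> length ys"
    using ex_has_least_nat[of W _ length] by blast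
  have "distinct xs"
  proof (rule ccontr)
    assume "\<not> distinct xs"
    then obtain as bs cs y where xs: "xs = as @ [y] @ bs @ [y] @ cs"
      using not_distinct_decomp by blast
    have "successively E (as @ [y] @ bs @ [y] @ cs)" using W by (simp add: W_def walk_def xs)
    then have "successively E as" "as = [] \<or> E (last as) y" "successively E (y # cs)"
      using successively_append_iff[of E as "y # bs @ y # cs"]
        successively_append_iff[of E "as @ [y] @ bs" "y # cs"] by auto
    then have "successively E (as @ [y] @ cs)" by (auto simp: successively_append_iff)
    moreover have "hd (as @ [y] @ cs) = hd xs" "last (as @ [y] @ cs) = last xs"
      by (simp_all add: xs hd_append)
    ultimately have "W (as @ [y] @ cs)" using W by (auto simp: W_def walk_def xs)
    from min[OF this] show False by (simp add: xs)
  qed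
  moreover have "set (tl xs) \<inter> X = {}"
  proof (rule ccontr)
    assume "\<not> ?thesis"
    then obtain x as bs where x: "x \<in> X" and tl: "tl xs = as @ x # bs"
      by (meson disjoint_iff split_list)
    then have xs: "xs = hd xs # as @ x # bs" using W by (metis W_def walk_def list.collapse)
    have "successively E (x # bs) \<and> set (x # bs) \<subseteq> U \<and> last (x # bs) = last xs"
    proof -
      have "successively E (hd xs # as @ x # bs)" "set (hd xs # as @ x # bs) \<subseteq> U"
        using W xs by (simp_all add: W_def walk_def)
      moreover have "last xs = last (x # bs)" by (subst xs) simp
      ultimately show ?thesis
        using successively_append_iff[of E "hd xs # as" "x # bs"] by auto
    qed
    then have "W (x # bs)" using W x by (simp add: W_def walk_def)
    from min[OF this] show False by (subst (asm) xs) simp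
  qed
  moreover have "set (butlast xs) \<inter> Y = {}"
  proof (rule ccontr)
    assume "\<not> ?thesis"
    then obtain y as bs where y: "y \<in> Y" and bl: "butlast xs = as @ y # bs"
      by (meson disjoint_iff split_list)
    then have xs: "xs = as @ y # bs @ [last xs]"
      using W append_butlast_last_id[of xs] by (simp add: W_def walk_def)
    have "successively E (as @ y # bs @ [last xs])" "set (as @ y # bs @ [last xs]) \<subseteq> U"
      "hd (as @ y # bs @ [last xs]) \<in> X"
      using W xs by (simp_all add: W_def walk_def)
    moreover from this(1) have "successively E (as @ [y])"
      using successively_append_iff[of E "as @ [y]" "bs @ [last xs]"] by simp
    ultimately have "W (as @ [y])" using y by (cases as) (simp_all add: W_def walk_def)
    from min[OF this] show False by (subst (asm) xs) simp
  qed
  ultimately show ?thesis using W that by (auto simp: W_def walk_def path_in_def)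
qed

lemma alternating_parity:
  "successively (\<lambda>x y. c x \<noteq> c y) xs \<Longrightarrow> xs \<noteq> [] \<Longrightarrow> c (hd xs) = c (last xs) \<longleftrightarrow> odd (length xs)"
  for c :: "'a \<Rightarrow> bool"
proof (induction xs)
  case (Cons x xs)
  then show ?case by (cases xs) auto
qed simp

text \<open>Once around the cycle, starting just after \<open>g s\<close>, and then out along
  \<open>xs\<close>. The path has at least \<open>n\<close> vertices, so its final segments realise
  every length below \<open>n\<close> with the same last vertex.\<close>

lemma path_in_cycle_tail:
  assumes cyc: "cycle_map E U n g" and xs: "path_in E U xs" "xs \<noteq> []" "hd xs = g s"
    "set (tl xs) \<inter> range g = {}"
  shows "path_in E U (map g [s - (n - 1)..s - 1] @ xs)"
proof (rule path_in_append[OF path_in_arc[OF cyc] xs(1)])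
  have n: "3 \<le> n" using cyc by (simp add: cycle_map_def)
  have "set xs = insert (g s) (set (tl xs))" using xs by (cases xs) auto
  then show "set (map g [s - (n - 1)..s - 1]) \<inter> set xs = {}"
    using xs(4) arcs_disjoint[OF cyc, of "s - 1" s s "s - (n - 1)"] by auto
  show "E (last (map g [s - (n - 1)..s - 1])) (hd xs)"
    using xs(3) n cycle_map_edge[OF cyc, of "s - 1"] by (simp add: last_map_upto)
qed auto

text \<open>The two colourings of the theta graph that the periodicity argument leaves open, constant and
  proper, are handled by a path leaving the cycle: in the first case up to a vertex of the other
  colour, in the second (where only even lengths are missing) across a monochromatic edge.\<close>

lemma theta_split_path_connected:
  assumes th: "theta_map E U n g r" and sym: "\<And>u v. E u v \<Longrightarrow> E v u" and irr: "\<And>v. \<not> E v v"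
    and conn: "connected_on U E"
    and mono: "u0 \<in> U" "v0 \<in> U" "E u0 v0" "c u0 = c v0"
    and nonconst: "a \<in> U" "b \<in> U" "c a \<noteq> c b"
    and l: "0 < l" "l < n"
  shows "split_path E U c (nat l)"
proof (rule ccontr)
  assume no: "\<not> split_path E U c (nat l)"
  have cyc: "cycle_map E U n g" using th by (simp add: theta_map_def)
  have n: "3 \<le> n" using cyc by (simp add: cycle_map_def)
  have C: "range g \<subseteq> U" "range g \<noteq> {}" using cycle_map_in[OF cyc] by auto
  show False
  proof (cases "\<forall>i. c (g i) = c (g 0)")
    case True
    define Y where "Y = {v \<in> U. c v \<noteq> c (g 0)}"
    have "Y \<noteq> {}" using nonconst by (auto simp: Y_def)
    then obtain xs where xs: "path_in E U xs" "xs \<noteq> []" "hd xs \<in> range g" "last xs \<in> Y"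
      "set (tl xs) \<inter> range g = {}" "set (butlast xs) \<inter> Y = {}"
      using shortest_path_between[OF conn C, of Y] by (auto simp: Y_def)
    then obtain s where s: "hd xs = g s" by blast
    define big where "big = map g [s - (n - 1)..s - 1] @ xs"
    have big: "path_in E U big" unfolding big_def
      by (rule path_in_cycle_tail[OF cyc xs(1,2) s xs(5)])
    have len: "nat n \<le> length big" using xs(2) n by (cases xs) (auto simp: big_def)
    have "set (butlast big) \<subseteq> range g \<union> set (butlast xs)" using xs(2) by (auto simp: big_def butlast_append)
    moreover have "c x = c (g 0)" if "x \<in> range g \<union> set (butlast xs)" for x
      using that xs(1,6) True in_set_butlastD[of x xs] by (auto simp: Y_def path_in_def)
    ultimately have bl: "c x = c (g 0)" if "x \<in> set (butlast big)" for x using that by blast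
    \<comment> \<open>The last \<open>l + 1\<close> vertices of \<open>big\<close>; all but the
      final one have the colour of the cycle.\<close>
    define ys where "ys = drop (length big - Suc (nat l)) big"
    have l': "nat l < length big" using l n len by auto
    then have "hd ys = butlast big ! (length big - Suc (nat l))"
      using l by (simp add: ys_def hd_drop_conv_nth nth_butlast)
    then have "hd ys \<in> set (butlast big)" using l' l by simp
    then have "c (hd ys) = c (g 0)" by (rule bl)
    moreover have "last ys = last xs" using l' xs(2) by (simp add: ys_def last_drop) (simp add: big_def)
    then have "c (last ys) \<noteq> c (g 0)" using xs(4) by (simp add: Y_def)
    moreover have "path_in E U ys" unfolding ys_def by (rule path_in_drop[OF big])
    moreover have "length ys = Suc (nat l)" using l' by (simp add: ys_def)
    ultimately have "split_path E U c (nat l)" by (intro split_pathI[of _ _ ys]) auto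
    with no show False ..
  next
    case False
    then obtain i0 where i0: "c (g i0) \<noteq> c (g 0)" by blast
    have alt: "c (g (i + 1)) \<noteq> c (g i)" for i
      using theta_split_path[OF th sym l no i0] by blast
    have "even (nat l)"
    proof (rule ccontr)
      assume odd: "odd (nat l)"
      have "successively (\<lambda>x y. c x \<noteq> c y) (map g [0..l])"
        unfolding successively_conv_nth using alt[of "int _"] by (auto simp: add.commute)
      moreover have "[0..l] \<noteq> []" using l by simp
      ultimately have "c (g 0) \<noteq> c (g l)"
        using alternating_parity[of c "map g [0..l]"] odd l
        by (auto simp: hd_map_upto last_map_upto nat_add_distrib)
      then show False using split_path_arc[OF cyc _ _ no, of 0] l by simp
    qed
    \<comment> \<open>Edges of the cycle are bichromatic, so such an edge would be a chord. Shifting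
      the cycle to start at \<open>g i\<close> gives another theta graph, whose chord must also be
      bichromatic.\<close>
    have chord: False if e: "E (g i) (g j)" "c (g i) = c (g j)" for i j
    proof -
      define q where "q = (j - i) mod n"
      have gq: "g (i + q) = g j" using cyc unfolding cycle_map_def q_def
        by (metis mod_add_right_eq add_diff_cancel_left' diff_add_cancel add.commute)
      have q: "0 \<le> q" "q < n" using n by (simp_all add: q_def)
      have "q \<noteq> 0" using gq e irr by auto
      moreover have "q \<noteq> 1" using gq e alt[of i] by auto
      moreover have "q \<noteq> n - 1"
        using gq e alt[of "i + (n - 1)"] cycle_map_period[OF cyc, of i] by (auto simp: algebra_simps)
      ultimately have "theta_map E U n (\<lambda>k. g (k + i)) q"
        using q cycle_map_shift[OF cyc, of i] e gq by (auto simp: theta_map_def add.commute)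
      from theta_split_path[OF this sym l no, of "i0 - i" "- i"] i0
      have "c (g (q + i)) \<noteq> c (g (0 + i))" by simp
      then show False using gq e by (simp add: add.commute)
    qed
    define Y where "Y = {u \<in> U. \<exists>v\<in>U. E u v \<and> c u = c v}"
    have Y: "Y \<subseteq> U" "Y \<noteq> {}" using mono by (auto simp: Y_def)
    \<comment> \<open>If the cycle meets \<open>Y\<close>, the path is a single cycle vertex. The
      last property then keeps \<open>v\<close> off the cycle: otherwise \<open>last xs\<close> and
      \<open>v\<close> would both lie on it, contrary to \<open>chord\<close>.\<close>
    obtain xs where xs: "path_in E U xs" "xs \<noteq> []" "hd xs \<in> range g" "last xs \<in> Y"
      "set (tl xs) \<inter> range g = {}" "set (butlast xs) \<inter> Y = {}"
      "range g \<inter> Y = {} \<or> last xs \<in> range g"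
    proof (cases "range g \<inter> Y = {}")
      case True
      then show ?thesis using shortest_path_between[OF conn C Y] that by metis
    next
      case False
      then obtain y where "y \<in> range g" "y \<in> Y" by blast
      then show ?thesis using that[of "[y]"] Y by (auto simp: path_in_def)
    qed
    obtain s where s: "hd xs = g s" using xs by blast
    obtain v where v: "v \<in> U" "E (last xs) v" "c (last xs) = c v" using xs by (auto simp: Y_def)
    have "last xs \<in> U" using xs(4) Y by blast
    then have vY: "v \<in> Y" using v sym by (auto simp: Y_def)
    have vg: "v \<notin> range g"
    proof
      assume vg: "v \<in> range g"
      with vY have "range g \<inter> Y \<noteq> {}" by blast
      with xs(7) have "last xs \<in> range g" by blast
      with vg obtain i j where "last xs = g i" "v = g j" by blast
      with chord[of i j] v show False by simp
    qed
    have "v \<noteq> last xs" using v irr by auto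
    have vxs: "v \<notin> set xs"
    proof
      assume "v \<in> set xs"
      then have "v \<in> set (butlast xs)"
        using \<open>v \<noteq> last xs\<close> append_butlast_last_id[OF xs(2)]
        by (metis UnE empty_iff empty_set set_ConsD set_append)
      with xs(6) vY show False by blast
    qed
    define big where "big = map g [s - (n - 1)..s - 1] @ xs"
    have big: "path_in E U big" unfolding big_def
      by (rule path_in_cycle_tail[OF cyc xs(1,2) s xs(5)])
    have len: "nat n \<le> length big" using xs(2) n by (cases xs) (auto simp: big_def)
    have "successively (\<lambda>x y. c x \<noteq> c y) (map g [s - (n - 1)..s - 1])"
      unfolding successively_conv_nth
    proof (intro allI impI)
      fix k assume "Suc k < length (map g [s - (n - 1)..s - 1])"
      then show "c (map g [s - (n - 1)..s - 1] ! k) \<noteq> c (map g [s - (n - 1)..s - 1] ! Suc k)"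
        using alt[of "s - (n - 1) + int k"] by (simp add: ac_simps)
    qed
    moreover have "successively (\<lambda>x y. c x \<noteq> c y) xs"
      unfolding successively_conv_nth
    proof (intro allI impI)
      fix k assume k: "Suc k < length xs"
      then have "xs ! k \<in> set (butlast xs)"
        by (metis Suc_lessE length_butlast less_diff_conv nth_butlast nth_mem plus_1_eq_Suc add.commute)
      then have "xs ! k \<notin> Y" using xs(6) by blast
      moreover have "xs ! k \<in> U" "xs ! Suc k \<in> U" "E (xs ! k) (xs ! Suc k)"
        using xs(1) k by (auto simp: path_in_def successively_conv_nth)
      ultimately show "c (xs ! k) \<noteq> c (xs ! Suc k)" by (auto simp: Y_def)
    qed
    moreover have "c (last (map g [s - (n - 1)..s - 1])) \<noteq> c (hd xs)"
      using alt[of "s - 1"] s n by (simp add: last_map_upto)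
    ultimately have altb: "successively (\<lambda>x y. c x \<noteq> c y) big"
      by (auto simp: big_def successively_append_iff)
    \<comment> \<open>Only \<open>l\<close> vertices this time. They alternate and \<open>l\<close>
      is even, so the ends differ; appending \<open>v\<close>, which repeats the last colour,
      supplies the missing edge without changing the end colour.\<close>
    define ys where "ys = drop (length big - nat l) big"
    have l': "nat l < length big" using l n len by auto
    have ys: "length ys = nat l" "ys \<noteq> []" "path_in E U ys" using l l' big
      by (auto simp: ys_def path_in_drop)
    have "last ys = last xs" using l' l xs(2) by (simp add: ys_def last_drop) (simp add: big_def)
    have "successively (\<lambda>x y. c x \<noteq> c y) ys"
      using altb unfolding ys_def by (metis append_take_drop_id successively_append_iff)
    then have "c (hd ys) \<noteq> c (last ys)"
      using alternating_parity[of c ys] ys \<open>even (nat l)\<close> by auto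
    moreover have "path_in E U (ys @ [v])"
    proof (rule path_in_append[OF ys(3)])
      have "set ys \<subseteq> range g \<union> set xs" using set_drop_subset[of "length big - nat l" big]
        by (auto simp: ys_def big_def)
      then show "set ys \<inter> set [v] = {}" using vg vxs by auto
    qed (use v \<open>last ys = last xs\<close> in \<open>auto simp: path_in_def\<close>)
    ultimately have "split_path E U c (nat l)"
      using ys v \<open>last ys = last xs\<close> by (intro split_pathI[of _ _ "ys @ [v]"]) auto
    with no show False ..
  qed
qed

section \<open>Critical graphs\<close>

text \<open>Vertex-criticality: \<open>colourable\<close> looks only at edges inside its set, so
  subsets stand for induced subgraphs.\<close>

definition critical :: "'a set \<Rightarrow> ('a \<Rightarrow> 'a \<Rightarrow> bool) \<Rightarrow> nat \<Rightarrow> bool" where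
  "critical U E d \<longleftrightarrow> finite U \<and> \<not> colourable U E d \<and> (\<forall>X. X \<subset> U \<longrightarrow> colourable X E d)"

lemma ex_critical_subset:
  assumes "finite V" "\<not> colourable V E d"
  shows "\<exists>U \<subseteq> V. critical U E d"
  using assms
proof (induction V rule: finite_psubset_induct)
  case (psubset V)
  show ?case
  proof (cases "critical V E d")
    case False
    then obtain X where X: "X \<subset> V" "\<not> colourable X E d"
      using psubset.hyps psubset.prems unfolding critical_def by blast
    from psubset.IH[OF this] X(1) show ?thesis by blast
  qed blast
qed

lemma colourableE:
  assumes "colourable U E d"
  obtains c where "\<forall>v\<in>U. c v < d" "\<forall>u\<in>U. \<forall>v\<in>U. E u v \<longrightarrow> c u \<noteq> c v"
  using assms unfolding colourable_def by (elim exE conjE)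

text \<open>Colourings of two parts with no edge between them can be glued.\<close>

lemma critical_connected_on:
  assumes crit: "critical U E d" and sym: "\<And>u v. E u v \<Longrightarrow> E v u"
  shows "connected_on U E"
  unfolding connected_on_def
proof (intro allI impI)
  fix X assume X: "X \<subseteq> U" "X \<noteq> {}" "\<forall>x\<in>X. \<forall>y\<in>U. E x y \<longrightarrow> y \<in> X"
  show "X = U"
  proof (rule ccontr)
    assume "X \<noteq> U"
    then have "X \<subset> U" "U - X \<subset> U" using X(1,2) by blast+
    then have "colourable X E d" "colourable (U - X) E d"
      using crit unfolding critical_def by blast+
    obtain c1 where c1: "\<forall>v\<in>X. c1 v < d" "\<forall>u\<in>X. \<forall>v\<in>X. E u v \<longrightarrow> c1 u \<noteq> c1 v"
      using \<open>colourable X E d\<close> by (rule colourableE)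
    obtain c2 where c2: "\<forall>v\<in>U - X. c2 v < d"
        "\<forall>u\<in>U - X. \<forall>v\<in>U - X. E u v \<longrightarrow> c2 u \<noteq> c2 v"
      using \<open>colourable (U - X) E d\<close> by (rule colourableE)
    have same: "u \<in> X \<longleftrightarrow> v \<in> X" if "u \<in> U" "v \<in> U" "E u v" for u v
      using that X(3) sym[OF that(3)] by blast
    have "colourable U E d" unfolding colourable_def
    proof (rule exI[of _ "\<lambda>v. if v \<in> X then c1 v else c2 v"], intro conjI ballI impI)
      fix u v assume "u \<in> U" "v \<in> U" "E u v"
      then show "(if u \<in> X then c1 u else c2 u) \<noteq> (if v \<in> X then c1 v else c2 v)"
        using same[of u v] c1(2) c2(2) by (cases "u \<in> X") auto
    qed (use c1(1) c2(1) in auto)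
    with crit show False by (simp add: critical_def)
  qed
qed

text \<open>If \<open>v\<close> saw every neighbour of \<open>u\<close>, a colouring of
  \<open>U - {u}\<close> would extend by giving \<open>u\<close> the colour of
  \<open>v\<close>.\<close>

lemma critical_not_dominated:
  assumes crit: "critical U E d" and sym: "\<And>u v. E u v \<Longrightarrow> E v u" and irr: "\<And>v. \<not> E v v"
    and uv: "u \<in> U" "v \<in> U" "u \<noteq> v"
  shows "\<not> {w \<in> U. E u w} \<subseteq> {w \<in> U. E v w}"
proof
  assume sub: "{w \<in> U. E u w} \<subseteq> {w \<in> U. E v w}"
  have "colourable (U - {u}) E d" using crit uv by (auto simp: critical_def)
  then obtain c where c: "\<forall>w\<in>U - {u}. c w < d"
    "\<forall>w\<in>U - {u}. \<forall>x\<in>U - {u}. E w x \<longrightarrow> c w \<noteq> c x"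
    by (rule colourableE)
  have u: "c v \<noteq> c w" "c w \<noteq> c v" if "w \<in> U" "E u w" for w
  proof -
    have "w \<in> U - {u}" "E v w" "v \<in> U - {u}" using sub uv that irr by auto
    then have "c v \<noteq> c w" using c(2) by blast
    then show "c v \<noteq> c w" "c w \<noteq> c v" by simp_all
  qed
  have "colourable U E d" unfolding colourable_def
  proof (intro exI conjI ballI impI)
    fix w assume "w \<in> U"
    then show "(c(u := c v)) w < d" using c(1) uv by auto
  next
    fix w x assume "w \<in> U" "x \<in> U" "E w x"
    then show "(c(u := c v)) w \<noteq> (c(u := c v)) x"
      using c(2) u irr sym[of w x] by (cases "w = u"; cases "x = u") auto
  qed
  with crit show False by (simp add: critical_def)
qed

text \<open>With fewer than \<open>d\<close> neighbours, \<open>u\<close> would find a free colour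
  in a colouring of \<open>U - {u}\<close>.\<close>

lemma critical_degree:
  assumes crit: "critical U E d" and sym: "\<And>u v. E u v \<Longrightarrow> E v u" and irr: "\<And>v. \<not> E v v"
    and u: "u \<in> U"
  shows "d \<le> card {w \<in> U. E u w}"
proof (rule ccontr)
  assume less: "\<not> d \<le> card {w \<in> U. E u w}"
  have "colourable (U - {u}) E d" using crit u by (auto simp: critical_def)
  then obtain c where c: "\<forall>w\<in>U - {u}. c w < d"
    "\<forall>w\<in>U - {u}. \<forall>x\<in>U - {u}. E w x \<longrightarrow> c w \<noteq> c x"
    by (rule colourableE)
  have fin: "finite {w \<in> U. E u w}" using crit by (simp add: critical_def)
  have "card (c ` {w \<in> U. E u w}) < card {..<d}"
    using card_image_le[OF fin, of c] less by simp
  then have "\<not> {..<d} \<subseteq> c ` {w \<in> U. E u w}"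
    using card_mono[of "c ` {w \<in> U. E u w}" "{..<d}"] fin by auto
  then obtain a where a: "a < d" "a \<notin> c ` {w \<in> U. E u w}" by blast
  have "colourable U E d" unfolding colourable_def
  proof (intro exI conjI ballI impI)
    fix w assume "w \<in> U"
    then show "(c(u := a)) w < d" using c(1) a by auto
  next
    fix w x assume "w \<in> U" "x \<in> U" "E w x"
    then show "(c(u := a)) w \<noteq> (c(u := a)) x"
      using c(2) a irr sym[of w x] by (cases "w = u"; cases "x = u") auto
  qed
  with crit show False by (simp add: critical_def)
qed

lemma successively_nthD: "successively P xs \<Longrightarrow> Suc i < length xs \<Longrightarrow> P (xs ! i) (xs ! Suc i)"
  by (simp add: successively_conv_nth)

text \<open>Of two neighbours of the first vertex of a path, the later closes a cycle and the
  earlier provides the chord.\<close>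

lemma theta_map_path:
  assumes xs: "path_in E U xs" and sym: "\<And>u v. E u v \<Longrightarrow> E v u"
    and i: "i < length xs" "E (xs ! 0) (xs ! i)" and r: "2 \<le> r" "r < i" "E (xs ! 0) (xs ! r)"
  shows "theta_map E U (int i + 1) (\<lambda>j. xs ! nat (j mod (int i + 1))) (int r)"
proof -
  let ?n = "int i + 1"
  have bd: "0 \<le> j mod ?n" "j mod ?n < ?n" for j
    by (rule pos_mod_sign pos_mod_bound, simp)+
  have lt: "nat (j mod ?n) < length xs" for j using bd[of j] i(1) by linarith
  have eq: "xs ! nat (j mod ?n) = xs ! nat (k mod ?n) \<longleftrightarrow> j mod ?n = k mod ?n" for j k
    using xs nth_eq_iff_index_eq[OF _ lt lt, of j k] eq_nat_nat_iff[OF bd(1) bd(1), of j k]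
    unfolding path_in_def by blast
  have edge: "E (xs ! nat (j mod ?n)) (xs ! nat ((j + 1) mod ?n))" for j
  proof (cases "j mod ?n = int i")
    case True
    then have "(j + 1) mod ?n = 0" using mod_add_left_eq[of j ?n 1] by simp
    then show ?thesis using True sym[OF i(2)] by simp
  next
    case False
    then have 1: "(j + 1) mod ?n = j mod ?n + 1"
      using bd[of j] by (subst mod_add_left_eq[symmetric], intro mod_pos_pos_trivial) auto
    have 2: "nat (j mod ?n + 1) = Suc (nat (j mod ?n))"
      using nat_add_distrib[OF bd(1), of 1 j] by simp
    have 3: "Suc (nat (j mod ?n)) < length xs" using False bd[of j] i(1) by linarith
    have "successively E xs" using xs unfolding path_in_def by blast
    from successively_nthD[OF this 3] show ?thesis unfolding 1 2 .
  qed
  have mem: "xs ! nat (j mod ?n) \<in> U" for j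
    using nth_mem[OF lt[of j]] xs unfolding path_in_def by blast
  have "3 \<le> ?n" using r by simp
  moreover have "range (\<lambda>j. xs ! nat (j mod ?n)) \<subseteq> U" using mem by blast
  ultimately have "cycle_map E U ?n (\<lambda>j. xs ! nat (j mod ?n))"
    unfolding cycle_map_def using eq edge by blast
  moreover have "int r mod ?n = int r" "(0::int) mod ?n = 0" using r by simp_all
  ultimately show ?thesis using r unfolding theta_map_def by (simp only: nat_int nat_0) simp
qed

section \<open>Long cycles with chords in triangle-free critical graphs\<close>

text \<open>A Posa rotation: the new path starts at the predecessor of the chosen neighbour of the
  old start, and \<open>zs\<close> stays in place.\<close>

lemma successively_rotate:
  assumes sym: "\<And>u v. E u v \<Longrightarrow> E v u" and xs: "successively E (ys @ zs)"
    and i: "0 < i" "i < length ys" "E (hd ys) (ys ! i)"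
  shows "successively E ((rev (take i ys) @ drop i ys) @ zs)"
proof -
  have ys: "ys @ zs = take i ys @ drop i ys @ zs" by simp
  have "successively E (take i ys)" "successively E (drop i ys @ zs)"
    using xs unfolding ys successively_append_iff[of E "take i ys"] by simp_all
  moreover have "(\<lambda>x y. E y x) = E" using sym by blast
  with \<open>successively E (take i ys)\<close> have "successively E (rev (take i ys))"
    by (simp only: successively_rev)
  moreover have "last (rev (take i ys)) = hd ys" "hd (drop i ys @ zs) = ys ! i" "take i ys \<noteq> []"
    using i by (auto simp: last_rev hd_take hd_drop_conv_nth hd_append)
  moreover note i(3)
  ultimately show ?thesis
    unfolding append_assoc successively_append_iff[of E "rev (take i ys)"] by simp
qed

text \<open>For a longest path \<open>xs\<close>, a neighbour of its first vertex at index at least \<open>2 * d + 1\<close> closes a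
  long cycle, and the degree supplies a chord. Otherwise all neighbours of the first vertex lie in the
  initial segment \<open>S\<close>, and the same holds for every reordering \<open>ys\<close> of that segment that is still
  a path followed by \<open>zs\<close> (\<open>good\<close>). Such starting vertices include the predecessors \<open>W\<close> of
  the neighbours \<open>N\<close> of the first vertex, and \<open>W \<union> N\<close> misses at most one vertex of \<open>S\<close>.
  With triangle-freeness this forces one neighbourhood to contain another, which criticality
  forbids.\<close>

lemma critical_theta:
  assumes crit: "critical U E d" and d: "3 \<le> d"
    and sym: "\<And>u v. E u v \<Longrightarrow> E v u" and irr: "\<And>v. \<not> E v v"
    and tf: "\<And>a b c. E a b \<Longrightarrow> E b c \<Longrightarrow> E c a \<Longrightarrow> False"
  shows "\<exists>n g r. theta_map E U n g r \<and> 2 * int d + 2 \<le> n"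
proof (rule ccontr)
  assume no: "\<not> ?thesis"
  have fin: "finite U" using crit by (simp add: critical_def)
  define nb where "nb v = {w \<in> U. E v w}" for v
  have fin_nb: "finite (nb v)" for v using fin by (simp add: nb_def)
  have deg: "d \<le> card (nb v)" if "v \<in> U" for v
    using critical_degree[OF crit sym irr that] by (simp add: nb_def)
  have dom: "\<not> nb u \<subseteq> nb v" if "u \<in> U" "v \<in> U" "u \<noteq> v" for u v
    using critical_not_dominated[OF crit sym irr that] by (simp add: nb_def)
  have "U \<noteq> {}" using crit by (auto simp: critical_def colourable_def)
  then obtain x where "x \<in> U" by blast
  then have "path_in E U [x]" by (simp add: path_in_def)
  moreover have "\<forall>xs. path_in E U xs \<longrightarrow> length xs < Suc (card U)"
    using fin by (metis card_mono distinct_card less_Suc_eq_le path_in_def)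
  ultimately obtain xs where xs: "path_in E U xs"
    and max: "\<And>ys. path_in E U ys \<Longrightarrow> length ys \<le> length xs"
    using ex_has_greatest_nat[of "path_in E U" "[x]" length] by blast
  from max[OF \<open>path_in E U [x]\<close>] have "xs \<noteq> []" by auto

  define S where "S = set (take (2 * d + 1) xs)"
  define zs where "zs = drop (2 * d + 1) xs"
  define good where "good ys \<longleftrightarrow> distinct ys \<and> set ys = S \<and> successively E (ys @ zs)" for ys
  have SU: "S \<subseteq> U" using xs set_take_subset[of "2 * d + 1" xs] by (auto simp: S_def path_in_def)
  have dxs: "distinct (take (2 * d + 1) xs @ zs)" using xs by (simp add: zs_def path_in_def)
  have card_S: "card S = min (length xs) (2 * d + 1)"
    using dxs by (simp add: S_def distinct_card)
  have good_path: "path_in E U (ys @ zs)" "length (ys @ zs) = length xs" "length ys = card S" "ys \<noteq> []"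
    if "good ys" for ys
  proof -
    show len: "length ys = card S" using that by (metis good_def distinct_card)
    then show "length (ys @ zs) = length xs" by (simp add: card_S zs_def)
    show "ys \<noteq> []" using len \<open>xs \<noteq> []\<close> by (auto simp: card_S min_def split: if_splits)
    have "set zs \<subseteq> U" using xs set_drop_subset[of "2 * d + 1" xs] by (auto simp: zs_def path_in_def)
    then show "path_in E U (ys @ zs)" using that dxs SU
      by (auto simp: good_def path_in_def S_def)
  qed
  have good_end: "nb (hd ys) \<subseteq> S" if "good ys" for ys
  proof
    fix w assume w: "w \<in> nb (hd ys)"
    note g = good_path[OF that]
    have hd: "(ys @ zs) ! 0 = hd ys" using g(4) by (simp add: nth_append hd_conv_nth)
    have on_path: "nb (hd ys) \<subseteq> set (ys @ zs)"
    proof (rule ccontr)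
      assume "\<not> ?thesis"
      then obtain y where y: "y \<in> U" "E (hd ys) y" "y \<notin> set (ys @ zs)" by (auto simp: nb_def)
      then have "path_in E U (y # ys @ zs)" using g(1,4) sym[OF y(2)]
        by (cases ys) (auto simp: path_in_def)
      from max[OF this] g(2) show False by simp
    qed
    show "w \<in> S"
    proof (rule ccontr)
      assume "w \<notin> S"
      from w on_path obtain i where i: "i < length (ys @ zs)" "(ys @ zs) ! i = w"
        by (metis in_set_conv_nth subsetD)
      have "\<not> i < length ys"
      proof
        assume "i < length ys"
        then have "w \<in> set ys" using i by (auto simp: nth_append)
        with \<open>w \<notin> S\<close> that show False by (simp add: good_def)
      qed
      then have i_ge: "2 * d + 1 \<le> i" using i(1) g(2,3) card_S by auto
      have "hd ys \<in> U" using g SU that by (auto simp: good_def)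
      \<comment> \<open>As \<open>d >= 3\<close>, there is a neighbour other than \<open>w\<close>
        and the second vertex of the path. Whichever of it and \<open>w\<close> comes later closes
        the cycle, the other gives the chord.\<close>
      have "card {(ys @ zs) ! 1, w} \<le> 2" by (simp add: card_insert_if)
      then have "\<not> nb (hd ys) \<subseteq> {(ys @ zs) ! 1, w}"
        using deg[OF \<open>hd ys \<in> U\<close>] d card_mono[of "{(ys @ zs) ! 1, w}" "nb (hd ys)"] by auto
      then obtain y where y: "y \<in> nb (hd ys)" "y \<noteq> (ys @ zs) ! 1" "y \<noteq> w" by blast
      with on_path obtain r where r: "r < length (ys @ zs)" "(ys @ zs) ! r = y"
        by (metis in_set_conv_nth subsetD)
      have E: "E ((ys @ zs) ! 0) ((ys @ zs) ! r)" "E ((ys @ zs) ! 0) ((ys @ zs) ! i)"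
        using y(1) w r i hd by (auto simp: nb_def)
      have "r \<noteq> 0" using E(1) irr by metis
      moreover have "r \<noteq> 1" "r \<noteq> i" using y r i by auto
      ultimately consider "2 \<le> r" "r < i" | "i < r" by linarith
      then show False
      proof cases
        case 1
        from theta_map_path[OF g(1) sym i(1) E(2) 1 E(1)] i_ge no show False by force
      next
        case 2
        have "2 \<le> i" using i_ge d by simp
        from theta_map_path[OF g(1) sym r(1) E(1) this 2 E(2)] i_ge 2 no show False by force
      qed
    qed
  qed
  have good_rotate: "good (rev (take i ys) @ drop i ys) \<and> hd (rev (take i ys) @ drop i ys) = ys ! (i - 1)"
    if "good ys" "0 < i" "i < length ys" "E (hd ys) (ys ! i)" for ys i
  proof
    have "set (take i ys) \<union> set (drop i ys) = set ys" by (metis append_take_drop_id set_append)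
    moreover have "distinct (take i ys @ drop i ys)" using that by (simp add: good_def)
    then have "set (take i ys) \<inter> set (drop i ys) = {}" by (simp only: distinct_append)
    ultimately show "good (rev (take i ys) @ drop i ys)"
      using that successively_rotate[of E ys zs i, OF sym _ that(2-4)] by (simp add: good_def)
    have "take i ys \<noteq> []" using that by auto
    then show "hd (rev (take i ys) @ drop i ys) = ys ! (i - 1)"
      using that by (simp add: hd_rev last_conv_nth)
  qed

  define ys where "ys = take (2 * d + 1) xs"
  define v where "v i = ys ! i" for i
  define p where "p = card S"
  have good: "good ys" using xs by (simp add: good_def ys_def S_def zs_def path_in_def)
  note g = good_path[OF good]
  have len: "length ys = p" using g(3) by (simp add: p_def)
  have p: "p \<le> 2 * d + 1" by (simp add: p_def card_S)
  have v_inj: "v i = v j \<longleftrightarrow> i = j" if "i < p" "j < p" for i j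
    using good that len by (simp add: v_def nth_eq_iff_index_eq good_def)
  have S_v: "S = v ` {..<p}"
    using good len by (auto simp: good_def v_def set_conv_nth image_def)
  have v_edge: "E (v i) (v (Suc i))" if "Suc i < p" for i
    using good that len unfolding good_def v_def successively_append_iff
    by (intro successively_nthD[of E]) simp_all
  have v0: "hd ys = v 0" using g(4) by (simp add: v_def hd_conv_nth)
  define N where "N = nb (v 0)"
  define I where "I = {i. i < p \<and> E (v 0) (v i)}"
  define W where "W = (\<lambda>i. v (i - 1)) ` I"
  have vU: "v i \<in> U" if "i < p" for i using that S_v SU by blast
  have N_sub: "N \<subseteq> S" using good_end[OF good] by (simp add: v0 N_def)
  have N_I: "N = v ` I" using N_sub vU by (auto simp: N_def nb_def I_def S_v)
  have p0: "0 < p" using g(4) len by (metis length_greater_0_conv)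
  have card_N: "d \<le> card N" using deg[OF vU[OF p0]] by (simp add: N_def)
  have finI: "finite I" by (simp add: I_def)
  have "card N = card I" unfolding N_I
    by (rule card_image) (auto simp: inj_on_def I_def v_inj)
  have I0: "0 \<notin> I" using irr by (simp add: I_def)
  have I_less: "i < p" if "i \<in> I" for i using that by (simp add: I_def)
  have card_W: "card W = card N" unfolding W_def \<open>card N = card I\<close>
  proof (rule card_image, rule inj_onI)
    fix i j assume ij: "i \<in> I" "j \<in> I" "v (i - 1) = v (j - 1)"
    then have "i - 1 = j - 1" using v_inj[of "i - 1" "j - 1"] I_less by (meson less_imp_diff_less)
    moreover have "i \<noteq> 0" "j \<noteq> 0" using ij I0 by metis+
    ultimately show "i = j" by simp
  qed
  have v_N: "v i \<in> N \<longleftrightarrow> i \<in> I" if "i < p" for i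
    using that vU by (auto simp: N_def nb_def I_def)
  have v_W: "v i \<in> W \<longleftrightarrow> Suc i \<in> I" if "i < p" for i
  proof
    assume "v i \<in> W"
    then obtain j where j: "j \<in> I" "v i = v (j - 1)" by (auto simp: W_def)
    then have "i = j - 1" using v_inj[of i "j - 1"] that I_less[of j] by simp
    moreover have "j \<noteq> 0" using j I0 by metis
    ultimately show "Suc i \<in> I" using j by simp
  qed (force simp: W_def)
  \<comment> \<open>Two consecutive neighbours on the path would form a triangle with
    \<open>v 0\<close>; hence \<open>W\<close> and \<open>N\<close> are disjoint.\<close>
  have consec: "Suc i \<notin> I" if "i \<in> I" for i
    using that tf[of "v 0" "v i" "v (Suc i)"] v_edge[of i] sym by (auto simp: I_def)
  have W_S: "W \<subseteq> S" unfolding W_def S_v using I_less by force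
  have W_N: "W \<inter> N = {}"
  proof -
    have "x \<notin> N" if x: "x \<in> W" for x
    proof -
      obtain i where i: "i < p" "x = v i" using x W_S S_v by blast
      then show ?thesis using x v_W v_N consec by blast
    qed
    then show ?thesis by blast
  qed
  have W_end: "nb w \<subseteq> S" if w: "w \<in> W" for w
  proof -
    obtain i where i: "i \<in> I" "w = v (i - 1)" using w by (auto simp: W_def)
    have "0 < i" using i I0 by (metis gr0I)
    then show ?thesis
      using good_rotate[OF good, of i] good_end[of "rev (take i ys) @ drop i ys"] i v0 len
      by (simp add: I_def v_def)
  qed
  have finS: "finite S" by (simp add: S_def)
  have "card N \<le> p" unfolding p_def by (rule card_mono[OF finS N_sub])
  then have "3 \<le> p" using card_N d by simp
  then have "Suc 0 \<in> I" using v_edge[of 0] by (simp add: I_def)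
  then have v0W: "v 0 \<in> W" using v_W p0 by blast
  have finNW: "finite N" "finite W" using finS N_sub W_S finite_subset by blast+
  have "card (W \<union> N) \<le> p" unfolding p_def by (rule card_mono[OF finS]) (use W_S N_sub in blast)
  then have "card W + card N \<le> p" using card_Un_disjoint[OF finNW(2,1) W_N] by simp
  then have card_d: "card N = d" "card W = d" using card_N card_W p by auto
  have Z_card: "card (S - (W \<union> N)) \<le> 1"
    using card_Diff_subset[of "W \<union> N" S] finNW card_Un_disjoint[OF finNW(2,1) W_N] card_d p W_S N_sub
    by (simp add: p_def)
  have Z_unique: "z = z'" if "z \<in> S - (W \<union> N)" "z' \<in> S - (W \<union> N)" for z z'
    using that Z_card finS card_le_Suc0_iff_eq[of "S - (W \<union> N)"] by auto
  have WU: "W \<subseteq> U" using W_S SU by blast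
  show False
  proof (cases "\<exists>w\<in>W. \<exists>w'\<in>W. E w w'")
    case False
    \<comment> \<open>Neighbours of \<open>w\<close> lie in \<open>N\<close> or are the single
      leftover vertex \<open>z\<close>. Neither of \<open>nb w\<close> and \<open>N\<close> contains
      the other, so the degree bound leaves only \<open>N\<close> with one vertex exchanged for
      \<open>z\<close>.\<close>
    have star: "\<exists>z\<in>S - (W \<union> N). \<exists>x\<in>N. nb w = insert z (N - {x})" if w: "w \<in> W" "w \<noteq> v 0" for w
    proof -
      have wU: "w \<in> U" using w WU by blast
      have sub: "nb w \<subseteq> N \<union> (S - (W \<union> N))" using W_end[OF w(1)] False w by (auto simp: nb_def)
      obtain z where z: "z \<in> nb w" "z \<notin> N" using dom[OF wU vU[OF p0] w(2)] by (auto simp: N_def)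
      obtain x where x: "x \<in> N" "x \<notin> nb w" using dom[OF vU[OF p0] wU] w(2) by (auto simp: N_def)
      have zZ: "z \<in> S - (W \<union> N)" using sub z by blast
      have "nb w \<subseteq> insert z (N - {x})" using sub x z Z_unique[OF zZ] by blast
      moreover have "card (insert z (N - {x})) = d" using z x finNW card_d d by simp
      ultimately have "nb w = insert z (N - {x})"
        using deg[OF wU] finNW by (intro card_seteq) auto
      then show ?thesis using zZ x by blast
    qed
    have "card (W - {v 0}) \<ge> 2" using v0W finNW card_d d by simp
    then obtain w1 where w1: "w1 \<in> W" "w1 \<noteq> v 0"
      by (metis Diff_iff card.empty ex_in_conv insertI1 not_numeral_le_zero)
    have "card (W - {v 0} - {w1}) \<ge> 1" using \<open>card (W - {v 0}) \<ge> 2\<close> w1 finNW by simp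
    then obtain w2 where w2: "w2 \<in> W" "w2 \<noteq> v 0" "w2 \<noteq> w1"
      by (metis Diff_iff One_nat_def card.empty ex_in_conv insertI1 not_one_le_zero)
    obtain z x1 where 1: "z \<in> S - (W \<union> N)" "x1 \<in> N" "nb w1 = insert z (N - {x1})" using star[OF w1] by blast
    obtain z' x2 where "z' \<in> S - (W \<union> N)" and 2: "x2 \<in> N" "nb w2 = insert z' (N - {x2})"
      using star[OF w2(1,2)] by blast
    then have z': "z' = z" using Z_unique 1 by blast
    have "x1 \<noteq> x2" using dom[of w2 w1] w1 w2 WU 1 2 z' by auto
    \<comment> \<open>As \<open>x1\<close> and \<open>x2\<close> differ, each \<open>y\<close> in
      \<open>N\<close> is adjacent to \<open>w1\<close> or \<open>w2\<close>, and both are adjacent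
      to \<open>z\<close>. Yet the predecessor of \<open>z\<close> on the path will turn out to lie
      in \<open>N\<close>.\<close>
    have zN: "\<not> E z y" if "y \<in> N" for y
    proof
      assume "E z y"
      have "y \<in> nb w1 \<or> y \<in> nb w2" using that 1 2 \<open>x1 \<noteq> x2\<close> by blast
      moreover have "z \<in> nb w1" "z \<in> nb w2" using 1 2 z' by auto
      ultimately show False using tf[of _ z y] \<open>E z y\<close> sym by (auto simp: nb_def)
    qed
    obtain i where i: "i < p" "z = v i" using 1 S_v by blast
    then have "i \<notin> I" "Suc i \<notin> I" using 1 v_N v_W by blast+
    have "i \<noteq> 0" using \<open>Suc i \<notin> I\<close> \<open>Suc 0 \<in> I\<close> by metis
    then have i1: "i - 1 < p" "Suc (i - 1) = i" using i by auto
    have "v (i - 1) \<in> N"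
    proof (rule ccontr)
      assume "v (i - 1) \<notin> N"
      moreover have "v (i - 1) \<notin> W" using v_W[OF i1(1)] i1(2) \<open>i \<notin> I\<close> by simp
      moreover have "v (i - 1) \<in> S" using S_v i1 by blast
      ultimately have "v (i - 1) = z" using Z_unique 1 by blast
      with i v_inj[of "i - 1" i] i1 show False by simp
    qed
    moreover have "E z (v (i - 1))" using v_edge[of "i - 1"] i1 i sym by simp
    ultimately show False using zN by blast
  next
    case True
    then obtain w w' where w: "w \<in> W" "w' \<in> W" "E w w'" by blast
    have not0: "w \<noteq> v 0" "w' \<noteq> v 0" using w W_N WU sym by (auto simp: N_def nb_def)
    have v0n: "v 0 \<notin> nb u" if "u \<in> W" for u using that W_N WU sym by (auto simp: N_def nb_def)
    have disj: "nb u \<inter> nb u' = {}" if "E u u'" for u u'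
      using that tf[of u u'] sym by (auto simp: nb_def)
    have "v 0 \<in> S" using v0W W_S by blast
    then have S0: "card (S - {v 0}) = p - 1" unfolding p_def by (rule card_Diff_singleton)
    \<comment> \<open>The two neighbourhoods are disjoint, have at least \<open>d\<close> elements
      each and fit into at most \<open>2 * d\<close> vertices, so they partition
      \<open>S - {v 0}\<close>.\<close>
    have un: "nb w \<union> nb w' \<subseteq> S - {v 0}" using W_end w v0n by blast
    have card_un: "card (nb w \<union> nb w') = card (nb w) + card (nb w')"
      using card_Un_disjoint[OF fin_nb fin_nb disj[OF w(3)]] .
    have degs: "d \<le> card (nb w)" "d \<le> card (nb w')" using w WU deg by blast+
    have "card (S - {v 0}) \<le> card (nb w \<union> nb w')" using S0 p card_un degs by simp
    then have un_eq: "nb w \<union> nb w' = S - {v 0}" using finS un by (intro card_seteq) auto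
    have p_eq: "p = 2 * d + 1" using un_eq S0 card_un degs p p0 by simp
    \<comment> \<open>Such a \<open>u\<close> is adjacent to \<open>w\<close> or \<open>w'\<close>.
      Its neighbourhood avoids that of the vertex it is adjacent to, so it lies in the other one,
      against \<open>dom\<close>.\<close>
    have "u = w \<or> u = w'" if u: "u \<in> W" "u \<noteq> v 0" for u
    proof (rule ccontr)
      assume ne: "\<not> ?thesis"
      have "u \<in> nb w \<union> nb w'" using un_eq u W_S by blast
      then have "E w u \<or> E w' u" by (auto simp: nb_def)
      then have "nb u \<inter> nb w = {} \<or> nb u \<inter> nb w' = {}" using disj sym by blast
      moreover have "nb u \<subseteq> nb w \<union> nb w'" using un_eq W_end[OF u(1)] v0n[OF u(1)] by blast
      ultimately have "nb u \<subseteq> nb w' \<or> nb u \<subseteq> nb w" by blast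
      then show False using dom[of u w] dom[of u w'] u w ne WU by blast
    qed
    then have W_eq: "W = {v 0, w, w'}" using w v0W by blast
    have "w \<noteq> w'" using w irr by auto
    have "d = 3" using card_d W_eq d card_insert_le_m1[of 3 "{w, w'}"] by (auto simp: card_insert_if split: if_splits)
    \<comment> \<open>The indices below leave a single configuration on seven vertices, in which the neighbourhood
        of \<open>v 1\<close> lies in that of \<open>v 3\<close>.\<close>
    then have p7: "p = 7" using p_eq by simp
    obtain i j where ij: "i < p" "j < p" "i < j" "{w, w'} = {v i, v j}"
    proof -
      obtain i j where "i < p" "w = v i" "j < p" "w' = v j" using w W_S S_v by blast
      then show ?thesis using that[of i j] that[of j i] \<open>w \<noteq> w'\<close> by (cases i j rule: linorder_cases) auto
    qed
    have Eij: "E (v i) (v j)" using ij(4) w(3) sym by (auto simp: doubleton_eq_iff)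
    have "{v i, v j} \<subseteq> W" using w unfolding ij(4)[symmetric] by blast
    then have inI: "Suc i \<in> I" "Suc j \<in> I" using v_W[OF ij(1)] v_W[OF ij(2)] by simp_all
    have "i \<noteq> 0" using ij not0 by auto
    have "i \<noteq> 1" using consec[OF \<open>Suc 0 \<in> I\<close>] inI by auto
    have "j \<noteq> Suc i" using consec[OF inI(1)] inI by auto
    have "j \<noteq> Suc (Suc i)"
      using tf[OF Eij, of "v (Suc i)"] v_edge[of i] v_edge[of "Suc i"] ij sym by auto
    have "Suc j < 7" using I_less[OF inI(2)] p7 by simp
    then have ij25: "i = 2" "j = 5"
      using \<open>i \<noteq> 0\<close> \<open>i \<noteq> 1\<close> \<open>j \<noteq> Suc i\<close> \<open>j \<noteq> Suc (Suc i)\<close> ij(3) by linarith+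
    have E03: "E (v 0) (v 3)" and E06: "E (v 0) (v 6)"
      using inI ij25 by (simp_all add: I_def eval_nat_numeral)
    have ys7: "ys = [v 0, v 1, v 2, v 3, v 4, v 5, v 6]"
      using len p7 by (intro nth_equalityI) (auto simp: v_def less_Suc_eq eval_nat_numeral)
    have S7: "S = {v 0, v 1, v 2, v 3, v 4, v 5, v 6}" using good unfolding good_def ys7 by auto
    have e: "E (v 0) (v 1)" "E (v 1) (v 2)" "E (v 2) (v 3)" "E (v 3) (v 4)" "E (v 4) (v 5)"
      using good unfolding good_def ys7 by auto
    \<comment> \<open>A reordering that starts at \<open>v 1\<close>, which is in \<open>N\<close>
      and so not covered by \<open>W_end\<close>. It uses the extra edges from \<open>v 2\<close> to
      \<open>v 5\<close> and from \<open>v 0\<close> to \<open>v 3\<close> and \<open>v 6\<close>,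
      and ends at \<open>v 6\<close> so that \<open>zs\<close> can follow.\<close>
    let ?ts = "[v 1, v 2, v 5, v 4, v 3, v 0, v 6]"
    have "successively E (v 6 # zs)" using good unfolding good_def ys7 by auto
    then have "successively E (?ts @ zs)" using e sym Eij ij25 E03 E06 by auto
    moreover have "distinct ?ts" using good unfolding good_def ys7 by auto
    ultimately have "good ?ts" by (auto simp: good_def S7)
    then have "nb (v 1) \<subseteq> S" using good_end[of ?ts] by simp
    moreover have "\<not> E (v 1) (v 3)" using tf[OF e(2) e(3)] sym by blast
    moreover have "\<not> E (v 1) (v 5)" using tf[OF e(2), of "v 5"] Eij ij25 sym by blast
    moreover have "\<not> E (v 1) (v 6)" using tf[OF sym[OF e(1)] E06] sym by blast
    ultimately have "v 1 \<notin> nb (v 1)" "v 3 \<notin> nb (v 1)" "v 5 \<notin> nb (v 1)" "v 6 \<notin> nb (v 1)"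
      and "nb (v 1) \<subseteq> S" using irr by (simp_all add: nb_def)
    then have "nb (v 1) \<subseteq> {v 0, v 2, v 4}" unfolding S7 by blast
    also have "\<dots> \<subseteq> nb (v 3)" using e E03 sym vU p7 by (auto simp: nb_def)
    finally show False using dom[of "v 1" "v 3"] vU[of 1] vU[of 3] v_inj[of 1 3] p7 by simp
  qed
qed

section \<open>Breadth-first levels\<close>

lemma bfs_levels:
  assumes conn: "connected_on U E" and root: "root \<in> U"
  shows "\<exists>(lev :: 'a \<Rightarrow> nat) p. (\<forall>v\<in>U. lev v = 0 \<longrightarrow> v = root)
    \<and> (\<forall>v\<in>U. 0 < lev v \<longrightarrow> p v \<in> U \<and> E (p v) v \<and> lev v = Suc (lev (p v)))
    \<and> (\<forall>u\<in>U. \<forall>v\<in>U. E u v \<longrightarrow> lev v \<le> Suc (lev u))"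
proof -
  define reach where "reach n = ((\<lambda>X. {v \<in> U. \<exists>u\<in>X. E u v}) ^^ n) {root}" for n
  have reach_0: "reach 0 = {root}" by (simp add: reach_def)
  have reach_Suc: "reach (Suc n) = {v \<in> U. \<exists>u\<in>reach n. E u v}" for n
    by (simp add: reach_def)
  have reach_U: "reach n \<subseteq> U" for n using root by (cases n) (auto simp: reach_0 reach_Suc)
  have "(\<Union>n. reach n) \<noteq> {}" using reach_0 by blast
  moreover have "\<forall>x\<in>\<Union>n. reach n. \<forall>y\<in>U. E x y \<longrightarrow> y \<in> (\<Union>n. reach n)"
    using reach_Suc by blast
  moreover have "(\<Union>n. reach n) \<subseteq> U" using reach_U by blast
  ultimately have all: "(\<Union>n. reach n) = U"
    using conn[unfolded connected_on_def, THEN spec, of "\<Union>n. reach n"] by blast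
  define lev where "lev v = (LEAST n. v \<in> reach n)" for v
  have lev: "v \<in> reach (lev v)" if "v \<in> U" for v
    unfolding lev_def by (rule LeastI_ex) (use that all in blast)
  have lev_le: "lev v \<le> n" if "v \<in> reach n" for v n
    unfolding lev_def using that by (rule Least_le)
  have step: "lev v \<le> Suc (lev u)" if "u \<in> U" "v \<in> U" "E u v" for u v
    using that lev[of u] by (intro lev_le) (auto simp: reach_Suc)
  have par: "\<exists>u. u \<in> U \<and> E u v \<and> lev v = Suc (lev u)" if v: "v \<in> U" "0 < lev v" for v
  proof -
    obtain n where n: "lev v = Suc n" using v(2) gr0_implies_Suc by blast
    then obtain u where u: "u \<in> reach n" "E u v" using lev[OF v(1)] by (auto simp: reach_Suc)
    then have "u \<in> U" using reach_U by blast
    then have "lev v = Suc (lev u)" using step[OF _ v(1) u(2)] lev_le[OF u(1)] n by simp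
    then show ?thesis using u \<open>u \<in> U\<close> by blast
  qed
  have "\<forall>v. \<exists>u. v \<in> U \<longrightarrow> 0 < lev v \<longrightarrow> u \<in> U \<and> E u v \<and> lev v = Suc (lev u)"
    using par by blast
  from choice[OF this] obtain p where
    p: "\<forall>v. v \<in> U \<longrightarrow> 0 < lev v \<longrightarrow> p v \<in> U \<and> E (p v) v \<and> lev v = Suc (lev (p v))"
    by (elim exE)
  have "v = root" if "v \<in> U" "lev v = 0" for v using lev[OF that(1)] that(2) reach_0 by simp
  then show ?thesis using p step by (intro exI[of _ lev] exI[of _ p]) simp
qed

lemma colourable_mono:
  assumes "colourable U E d" "d \<le> k"
  shows "colourable U E k"
proof -
  obtain c where c: "\<forall>v\<in>U. c v < d" "\<forall>u\<in>U. \<forall>v\<in>U. E u v \<longrightarrow> c u \<noteq> c v"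
    using assms(1) by (rule colourableE)
  then have "\<forall>v\<in>U. c v < k" using assms(2) by auto
  with c(2) show ?thesis unfolding colourable_def by (intro exI[of _ c] conjI)
qed

lemma colourable_levels:
  fixes lev :: "'a \<Rightarrow> nat"
  assumes lev: "\<And>u v. u \<in> U \<Longrightarrow> v \<in> U \<Longrightarrow> E u v \<Longrightarrow> lev v \<le> Suc (lev u)"
    and sym: "\<And>u v. E u v \<Longrightarrow> E v u"
    and col: "\<And>n. colourable {v \<in> U. lev v = n} E d"
  shows "colourable U E (2 * d)"
proof -
  have "\<exists>c :: 'a \<Rightarrow> nat. (\<forall>v\<in>U. lev v = n \<longrightarrow> c v < d)
      \<and> (\<forall>u\<in>U. \<forall>v\<in>U. lev u = n \<longrightarrow> lev v = n \<longrightarrow> E u v \<longrightarrow> c u \<noteq> c v)" for n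
  proof -
    obtain c where "\<forall>v\<in>{v \<in> U. lev v = n}. c v < d"
      "\<forall>u\<in>{v \<in> U. lev v = n}. \<forall>v\<in>{v \<in> U. lev v = n}. E u v \<longrightarrow> c u \<noteq> c v"
      using col[of n] by (rule colourableE)
    then show ?thesis by (intro exI[of _ c]) simp
  qed
  then have "\<forall>n. \<exists>c :: 'a \<Rightarrow> nat. (\<forall>v\<in>U. lev v = n \<longrightarrow> c v < d)
      \<and> (\<forall>u\<in>U. \<forall>v\<in>U. lev u = n \<longrightarrow> lev v = n \<longrightarrow> E u v \<longrightarrow> c u \<noteq> c v)" ..
  from choice[OF this] obtain c :: "nat \<Rightarrow> 'a \<Rightarrow> nat" where
    cs: "\<forall>n. (\<forall>v\<in>U. lev v = n \<longrightarrow> c n v < d)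
      \<and> (\<forall>u\<in>U. \<forall>v\<in>U. lev u = n \<longrightarrow> lev v = n \<longrightarrow> E u v \<longrightarrow> c n u \<noteq> c n v)" by (elim exE)
  then have c: "v \<in> U \<Longrightarrow> c (lev v) v < d"
      "u \<in> U \<Longrightarrow> v \<in> U \<Longrightarrow> lev u = lev v \<Longrightarrow> E u v \<Longrightarrow> c (lev v) u \<noteq> c (lev v) v" for u v
    by simp_all
  define f where "f v = c (lev v) v + d * (lev v mod 2)" for v
  have "f v < 2 * d" if "v \<in> U" for v
    using c(1)[OF that] by (cases "even (lev v)") (auto simp: f_def mod2_eq_if)
  moreover have "f u \<noteq> f v" if uv: "u \<in> U" "v \<in> U" "E u v" for u v
  proof (cases "lev u = lev v")
    case True
    with c(2)[OF uv(1,2) True uv(3)] show ?thesis by (simp add: f_def)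
  next
    case False
    then have "lev u = Suc (lev v) \<or> lev v = Suc (lev u)"
      using lev[OF uv] lev[OF uv(2,1) sym[OF uv(3)]] by linarith
    then have "even (lev u) \<noteq> even (lev v)" by auto
    then show ?thesis using c(1)[OF uv(1)] c(1)[OF uv(2)] by (auto simp: f_def mod2_eq_if)
  qed
  ultimately show ?thesis unfolding colourable_def by (intro exI[of _ f] conjI) simp_all
qed

lemma has_cycle_of_list:
  assumes "distinct xs" "successively E xs" "set xs \<subseteq> V" "E (last xs) (hd xs)" "3 \<le> length xs"
  shows "has_cycle_of_length V E (length xs)"
proof -
  have "E (xs ! i) (xs ! ((i + 1) mod length xs))" if "i < length xs" for i
  proof (cases "Suc i < length xs")
    case True
    with successively_nthD[OF assms(2) True] show ?thesis by simp
  next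
    case False
    then have "i = length xs - 1" "Suc i = length xs" using that by simp_all
    moreover have "xs \<noteq> []" using that by auto
    ultimately show ?thesis using assms(4) by (simp add: last_conv_nth hd_conv_nth)
  qed
  with assms show ?thesis unfolding has_cycle_of_length_def by blast
qed

text \<open>Let \<open>h\<close> be least such that all vertices of \<open>H\<close> share their ancestor \<open>h\<close> levels up, and let
  \<open>c\<close> record one value of the ancestor \<open>h - 1\<close> levels up. Differently coloured vertices then have tree
  paths of length \<open>h\<close> to the common ancestor that meet only there.\<close>

lemma level_paths_close_up:
  fixes lev :: "'a \<Rightarrow> nat"
  assumes root: "\<And>v. v \<in> U \<Longrightarrow> lev v = 0 \<Longrightarrow> v = root"
    and par: "\<And>v. v \<in> U \<Longrightarrow> 0 < lev v \<Longrightarrow> p v \<in> U \<and> E (p v) v \<and> lev v = Suc (lev (p v))"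
    and sym: "\<And>u v. E u v \<Longrightarrow> E v u"
    and H: "H \<subseteq> {v \<in> U. lev v = n}" and ab: "a \<in> H" "b \<in> H" "a \<noteq> b"
  shows "\<exists>h c. (\<exists>x\<in>H. \<exists>y\<in>H. c x \<noteq> c y)
    \<and> (\<forall>l>0. split_path E H c l \<longrightarrow> has_cycle_of_length U E (l + 2 * h))"
proof -
  define anc where "anc i v = (p ^^ i) v" for i v
  have anc: "anc i v \<in> U \<and> lev (anc i v) = n - i" if "v \<in> H" "i \<le> n" for v i
    using that(2)
  proof (induction i)
    case 0
    then show ?case using that(1) H by (auto simp: anc_def)
  next
    case (Suc i)
    then have "anc i v \<in> U" "lev (anc i v) = n - i" by simp_all
    moreover from this Suc.prems have "p (anc i v) \<in> U \<and> lev (anc i v) = Suc (lev (p (anc i v)))"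
      using par[of "anc i v"] by simp
    moreover have "anc (Suc i) v = p (anc i v)" by (simp add: anc_def)
    ultimately show ?case by simp
  qed
  have anc_edge: "E (anc (Suc i) v) (anc i v)" "E (anc i v) (anc (Suc i) v)"
    if "v \<in> H" "i < n" for v i
  proof -
    have "E (anc (Suc i) v) (anc i v)" using par[of "anc i v"] anc[of v i] that by (simp add: anc_def)
    then show "E (anc (Suc i) v) (anc i v)" "E (anc i v) (anc (Suc i) v)" using sym by blast+
  qed
  define Q where "Q i \<longleftrightarrow> (\<forall>x\<in>H. \<forall>y\<in>H. anc i x = anc i y)" for i
  have "anc n v = root" if "v \<in> H" for v using anc[OF that, of n] root[of "anc n v"] by simp
  then have "Q n" by (simp add: Q_def)
  define h where "h = (LEAST i. Q i)"
  have "Q h" unfolding h_def using \<open>Q n\<close> by (rule LeastI)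
  have "h \<le> n" unfolding h_def using \<open>Q n\<close> by (rule Least_le)
  have "\<not> Q 0" using ab by (auto simp: Q_def anc_def)
  with \<open>Q h\<close> have h0: "0 < h" by (cases h) auto
  then have "\<not> Q (h - 1)" unfolding h_def by (intro not_less_Least) (simp add: h_def[symmetric])
  then obtain x0 y0 where xy0: "x0 \<in> H" "y0 \<in> H" "anc (h - 1) x0 \<noteq> anc (h - 1) y0"
    by (auto simp: Q_def)
  define c where "c v \<longleftrightarrow> anc (h - 1) v = anc (h - 1) x0" for v
  have "\<exists>x\<in>H. \<exists>y\<in>H. c x \<noteq> c y" using xy0
    by (intro bexI[of _ x0] bexI[of _ y0]) (auto simp: c_def)
  moreover have "has_cycle_of_length U E (l + 2 * h)" if l: "0 < l" and sp: "split_path E H c l" for l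
  proof -
    from sp obtain ys where ys: "path_in E H ys" "length ys = Suc l" "c (hd ys) \<noteq> c (last ys)"
      by (auto simp: split_path_def)
    define x where "x = hd ys"
    define y where "y = last ys"
    have "ys \<noteq> []" using ys(2) by auto
    then have xy: "x \<in> H" "y \<in> H" using ys(1) by (auto simp: x_def y_def path_in_def)
    have ne: "anc (h - 1) x \<noteq> anc (h - 1) y" using ys(3) by (auto simp: c_def x_def y_def)
    \<comment> \<open>Ancestor lines that have met stay together, so meeting below height
      \<open>h\<close> would give equal ancestors at height \<open>h - 1\<close>.\<close>
    have anc_ne: "anc i x \<noteq> anc i y" if "i < h" for i
    proof
      assume "anc i x = anc i y"
      moreover have "h - 1 = (h - 1 - i) + i" using that by simp
      then have "anc (h - 1) v = anc (h - 1 - i) (anc i v)" for v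
        unfolding anc_def by (metis comp_apply funpow_add)
      ultimately show False using ne by simp
    qed
    \<comment> \<open>The common ancestor is counted in \<open>up\<close> only:
      \<open>l + 1\<close>, \<open>h\<close> and \<open>h - 1\<close> vertices add up to
      \<open>l + 2 * h\<close>. For \<open>h = 1\<close> the list \<open>down\<close> is
      empty.\<close>
    define up where "up = map (\<lambda>i. anc i y) [1..<Suc h]"
    define down where "down = rev (map (\<lambda>i. anc i x) [1..<h])"
    have succ: "successively E (map (\<lambda>i. anc i v) [1..<j])" "successively E (rev (map (\<lambda>i. anc i v) [1..<j]))"
      if "v \<in> H" "j \<le> Suc h" for v j
    proof -
      have s: "successively P (map (\<lambda>i. anc i v) [1..<j])" if "\<And>i. i < n \<Longrightarrow> P (anc i v) (anc (Suc i) v)" for P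
        unfolding successively_conv_nth using that \<open>j \<le> Suc h\<close> \<open>h \<le> n\<close> by auto
      show "successively E (map (\<lambda>i. anc i v) [1..<j])" using anc_edge[OF that(1)] by (intro s)
      show "successively E (rev (map (\<lambda>i. anc i v) [1..<j]))"
        unfolding successively_rev using anc_edge[OF that(1)] by (intro s)
    qed
    have inj: "inj_on (\<lambda>i. anc i v) {..h}" if "v \<in> H" for v
    proof (rule inj_onI)
      fix i j assume ij: "i \<in> {..h}" "j \<in> {..h}" "anc i v = anc j v"
      then have "n - i = n - j" using anc[OF that, of i] anc[OF that, of j] \<open>h \<le> n\<close> by simp
      then show "i = j" using ij \<open>h \<le> n\<close> by simp
    qed
    have dist: "distinct up" "distinct down"
      using inj[OF xy(2)] inj[OF xy(1)] by (auto simp: up_def down_def distinct_map inj_on_def)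
    have lev_eq: "i = j" if "anc i u = anc j v" "u \<in> H" "v \<in> H" "i \<le> h" "j \<le> h" for i j u v
      using anc[OF that(2), of i] anc[OF that(3), of j] that \<open>h \<le> n\<close> by simp
    have up_E: "\<exists>i. 1 \<le> i \<and> i \<le> h \<and> z = anc i y" if "z \<in> set up" for z
      using that by (auto simp: up_def)
    have down_E: "\<exists>i. 1 \<le> i \<and> i < h \<and> z = anc i x" if "z \<in> set down" for z
      using that by (auto simp: down_def)
    have "anc i x \<noteq> anc j y" if "i < h" "j \<le> h" for i j
      using lev_eq[of i x j y] anc_ne[of i] that xy by auto
    then have disj1: "set up \<inter> set down = {}" using up_E down_E by blast
    have new: "z \<noteq> anc i w" if "z \<in> H" "w \<in> H" "1 \<le> i" "i \<le> h" for z w i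
      using lev_eq[of 0 z i w] that by (auto simp: anc_def)
    have "z \<notin> H" if "z \<in> set up \<union> set down" for z
      using that up_E[of z] down_E[of z] new[of z] xy less_imp_le by blast
    then have disj2: "set ys \<inter> (set up \<union> set down) = {}"
      using ys(1) unfolding path_in_def by blast
    have "set up \<union> set down \<subseteq> U" using anc xy \<open>h \<le> n\<close> by (auto simp: up_def down_def)
    then have setU: "set (ys @ up @ down) \<subseteq> U" using ys(1) H by (auto simp: path_in_def)
    have "anc h y = anc h x" using \<open>Q h\<close> xy unfolding Q_def by blast
    then have up: "up \<noteq> []" "hd up = anc 1 y" "last up = anc h x"
      using h0 by (simp_all add: up_def hd_map last_map del: upt_Suc)
    have down: "hd down = anc (h - 1) x" "last down = anc 1 x" if "down \<noteq> []"
      using that by (auto simp: down_def hd_rev last_rev hd_map last_map)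
    have "down = [] \<longleftrightarrow> h = 1" using h0 by (auto simp: down_def)
    have "E (last ys) (hd up)" using anc_edge(2)[OF xy(2), of 0] h0 \<open>h \<le> n\<close> up
      by (simp add: y_def anc_def)
    moreover have "E (last up) (hd down)" if "down \<noteq> []"
      using anc_edge(1)[OF xy(1), of "h - 1"] h0 \<open>h \<le> n\<close> up down that by simp
    moreover have "successively E ys" using ys(1) by (simp add: path_in_def)
    moreover have "successively E up" unfolding up_def using xy by (intro succ(1)) simp_all
    moreover have "successively E down" unfolding down_def using xy by (intro succ(2)) simp_all
    ultimately have "successively E (ys @ up @ down)" using up(1)
      by (cases "down = []") (simp_all add: successively_append_iff)
    moreover have "distinct (ys @ up @ down)" using dist disj1 disj2 ys(1) by (auto simp: path_in_def)
    moreover have "last (ys @ up @ down) = anc 1 x"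
      using up down \<open>down = [] \<longleftrightarrow> h = 1\<close> by (cases "down = []") auto
    then have "E (last (ys @ up @ down)) (hd (ys @ up @ down))"
      using anc_edge(1)[OF xy(1), of 0] h0 \<open>h \<le> n\<close> \<open>ys \<noteq> []\<close> by (simp add: x_def anc_def)
    moreover have len: "length (ys @ up @ down) = l + 2 * h"
      using ys(2) h0 by (simp add: up_def down_def)
    ultimately show ?thesis
      using has_cycle_of_list[of "ys @ up @ down" E U] setU l h0 by simp
  qed
  ultimately show ?thesis by blast
qed

lemma has_cycle_of_length_mono:
  assumes "has_cycle_of_length U E n" "U \<subseteq> V"
  shows "has_cycle_of_length V E n"
proof -
  from assms(1) obtain vs where "3 \<le> n" "length vs = n" "distinct vs" "set vs \<subseteq> U"
    "\<forall>i<n. E (vs ! i) (vs ! ((i + 1) mod n))"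
    unfolding has_cycle_of_length_def by (elim conjE exE)
  moreover from this(4) assms(2) have "set vs \<subseteq> V" by (rule subset_trans)
  ultimately show ?thesis unfolding has_cycle_of_length_def by (intro conjI exI[of _ vs])
qed

theorem theorem5p1:
  fixes V :: "'a set" and E :: "'a \<Rightarrow> 'a \<Rightarrow> bool" and k :: nat
  assumes "k \<ge> 6"
    and "simple_graph V E"
    and "chromatic_number V E = k + 1"
    and "triangle_free V E"
  shows "\<exists>l. \<forall>j<k. has_cycle_of_length V E (l + j)"
proof -
  have sym: "E u v \<Longrightarrow> E v u" and irr: "\<not> E v v" and inV: "E u v \<Longrightarrow> u \<in> V" and "finite V" for u v
    using assms(2) by (auto simp: simple_graph_def)
  have tf: False if "E a b" "E b c" "E c a" for a b c
    using assms(4) that inV unfolding triangle_free_def by blast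
  have "\<not> colourable V E k"
    using assms(3) not_less_Least[of k "colourable V E"] by (simp add: chromatic_number_def)
  then obtain U where U: "U \<subseteq> V" "critical U E k"
    using ex_critical_subset[OF \<open>finite V\<close>] by blast
  then have "U \<noteq> {}" by (auto simp: critical_def colourable_def)
  then obtain root where "root \<in> U" by blast
  have "connected_on U E" by (rule critical_connected_on[OF U(2) sym])
  then obtain lev :: "'a \<Rightarrow> nat" and p where levels: "(\<forall>v\<in>U. lev v = 0 \<longrightarrow> v = root)
    \<and> (\<forall>v\<in>U. 0 < lev v \<longrightarrow> p v \<in> U \<and> E (p v) v \<and> lev v = Suc (lev (p v)))
    \<and> (\<forall>u\<in>U. \<forall>v\<in>U. E u v \<longrightarrow> lev v \<le> Suc (lev u))"
    using \<open>root \<in> U\<close> by (rule bfs_levels[elim_format]) (elim exE)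
  then have lev: "v \<in> U \<Longrightarrow> lev v = 0 \<Longrightarrow> v = root"
    "v \<in> U \<Longrightarrow> 0 < lev v \<Longrightarrow> p v \<in> U \<and> E (p v) v \<and> lev v = Suc (lev (p v))"
    "u \<in> U \<Longrightarrow> v \<in> U \<Longrightarrow> E u v \<Longrightarrow> lev v \<le> Suc (lev u)" for u v
    by simp_all
  define d where "d = k div 2"
  have d: "3 \<le> d" "2 * d \<le> k" "k \<le> 2 * d + 1" using assms(1) by (auto simp: d_def)
  have "\<not> colourable U E (2 * d)"
    using U(2) colourable_mono[of U E "2 * d" k] d by (auto simp: critical_def)
  moreover have "colourable U E (2 * d)" if "\<And>n. colourable {v \<in> U. lev v = n} E d"
    by (rule colourable_levels[OF lev(3) sym that])
  ultimately obtain n where layer: "\<not> colourable {v \<in> U. lev v = n} E d" by blast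
  have "finite {v \<in> U. lev v = n}" using U(2) by (simp add: critical_def)
  from ex_critical_subset[OF this layer]
  obtain H where H: "H \<subseteq> {v \<in> U. lev v = n}" "critical H E d" by (elim exE conjE)
  have "\<exists>m g r. theta_map E H m g r \<and> 2 * int d + 2 \<le> m"
    by (rule critical_theta[OF H(2) d(1) sym irr tf])
  then obtain m g r where th: "theta_map E H m g r" "2 * int d + 2 \<le> m" by blast
  have cyc: "cycle_map E H m g" using th(1) by (simp add: theta_map_def)
  have "g 0 \<noteq> g 1" using cycle_map_edge[OF cyc, of 0] irr by auto
  have "\<exists>h c. (\<exists>x\<in>H. \<exists>y\<in>H. c x \<noteq> c y)
      \<and> (\<forall>l>0. split_path E H c l \<longrightarrow> has_cycle_of_length U E (l + 2 * h))"
    by (rule level_paths_close_up[of U lev root p E H n, OF lev(1,2) sym H(1) cycle_map_in[OF cyc, of 0]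
        cycle_map_in[OF cyc, of 1] \<open>g 0 \<noteq> g 1\<close>])
  then obtain h c where nonconst: "\<exists>x\<in>H. \<exists>y\<in>H. c x \<noteq> c y" and
    close: "\<forall>l>0. split_path E H c l \<longrightarrow> has_cycle_of_length U E (l + 2 * h)"
    by (elim exE conjE)
  have conn: "connected_on H E" by (rule critical_connected_on[OF H(2) sym])
  have "\<exists>u\<in>H. \<exists>v\<in>H. E u v \<and> c u = c v"
  proof (rule ccontr)
    assume "\<not> ?thesis"
    then have "colourable H E 2" unfolding colourable_def
      by (intro exI[of _ "\<lambda>v. if c v then 0 else 1"] conjI) auto
    then have "colourable H E d" using d(1) by (elim colourable_mono) simp
    with H(2) show False by (simp add: critical_def)
  qed
  then obtain u0 v0 where mono: "u0 \<in> H" "v0 \<in> H" "E u0 v0" "c u0 = c v0" by blast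
  obtain x y where xy: "x \<in> H" "y \<in> H" "c x \<noteq> c y" using nonconst by blast
  \<comment> \<open>Path lengths \<open>Suc j\<close> run from 1 to \<open>k\<close>, and
    \<open>k \<le> 2 * d + 1 < m\<close> keeps them below the length of the cycle.\<close>
  have "has_cycle_of_length V E (Suc (2 * h) + j)" if "j < k" for j
  proof -
    have "split_path E H c (nat (int (Suc j)))"
      by (rule theta_split_path_connected[OF th(1) sym irr conn mono xy])
        (use that d th(2) in auto)
    then have "split_path E H c (Suc j)" by (simp only: nat_int)
    from close[rule_format, OF zero_less_Suc this]
    have "has_cycle_of_length U E (Suc j + 2 * h)" .
    then show ?thesis using has_cycle_of_length_mono[OF _ U(1)] by (simp add: add.commute)
  qed
  then show ?thesis by blast
qed

end
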